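(* Let $p>1$, let $x\in\mathscr R_p([0,T])$ with intrinsic energy measure $\mu^{p,x}$. Suppose $y\in C([0,T];\mathbb R)$ and $g\in C([0,T];\mathbb R)$ satisfy $$\lim_{\delta\downarrow0}\sup_{0<\ell\le\delta}\sup_{0\le a<\ell}\mathcal Q_p(y\mid x,g;\ell,a)=0.\qquad( * )$$ Then, with $B_g(t):=\int_{[0,t]}|g(s)|^p\,\mu^{p,x}(ds)$, $$\lim_{\delta\downarrow0}\sup_{0<\ell\le\delta}\sup_{0\le a<\ell}\sup_{t\in[0,T]}\left|\mathsf V^p_{\Pi(\ell,a)}(y;t)-B_g(t)\right|=0.$$ Consequently, if $B_g(T)>0$, then $y\in\mathscr R_p([0,T])$, $\mu^{p,y}=|g|^p\mu^{p,x}$ and $[y]^p(t)=B_g(t)$. If $B_g(T)=0$, the same convergence holds with zero limiting $p$-energy, so only the nondegeneracy requirement $A(T)>0$ in the definition of $p$-roughness fails. In particular: (i) (Smooth transformations.) If $F\in C^1(U)$ on a neighbourhood $U$ of $x([0,T])$ and $y=F\circ x$, then $( * )$ holds with $g(t)=F'(x(t))$, and $y$ has limiting energy $[y]^p(t)=\int_{[0,t]}|F'(x(s))|^p\mu^{p,x}(ds)$. Thus $F\circ x$ is $p$-rough whenever this quantity is positive at $t=T$; in particular this is automatic if $F'$ is bounded away from zero on $x([0,T])$. (ii) (Addition of a smoother path.) If $y=x+z$ with $z\in C([0,T];\mathbb R)$ and $$\lim_{\delta\downarrow0}\sup_{0<\ell\le\delta}\sup_{0\le a<\ell}\sup_{t\in[0,T]}\mathsf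 V^p_{\Pi(\ell,a)}(z;t)=0,$$ then $y\in\mathscr R_p([0,T])$ and $\mu^{p,y}=\mu^{p,x}$. This condition holds, for example, when $z$ is continuous of finite variation, or when $z\in C^\alpha$ for some $\alpha>1/p$. (iii) (Pathwise integration.) Let $p\ge2$ be an even integer and $f\in C^p(\mathbb R)$. The compensated pathwise integral (defined in the context), taken along any sequence of shifted uniform grids with vanishing mesh, defines the same path $$Y(t)=\int_0^tf'(x(s))\,\mathrm d^{\mathrm{CP}}x(s)=f(x(t))-f(x(0))-\frac1{p!}\int_{[0,t]}f^{(p)}(x(s))\,\mu^{p,x}(ds).$$ Then $( * )$ holds with $y=Y$ and $g=f'\circ x$, and hence $Y$ has limiting energy $[Y]^p(t)=\int_{[0,t]}|f'(x(s))|^p\mu^{p,x}(ds)$. Thus $Y$ is $p$-rough whenever this energy is nonzero.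
   Context: Stopped $p$-energy: for a finite partition $\lambda=\{0=u_0<\dots<u_N=T\}$ and $t\in[0,T]$, $\mathsf V^p_\lambda(x;t):=\sum_{i=0}^{N-1}|x(u_{i+1}\wedge t)-x(u_i\wedge t)|^p$. Shifted uniform grids: for $0<\ell\le T$, $0\le a<\ell$, $\Pi(\ell,a):=\{0,T\}\cup\{a+k\ell: k\in\mathbb Z,\ 0<a+k\ell<T\}$. $\mathscr R_p([0,T])$ is the class of $p$-rough paths: $x\in C([0,T];\mathbb R)$ for which there is a continuous nondecreasing $A:[0,T]\to[0,\infty)$ with $A(T)>A(0)=0$ such that $\sup_{0<\ell\le\delta}\sup_{0\le a<\ell}\sup_{t\in[0,T]}|\mathsf V^p_{\Pi(\ell,a)}(x;t)-A(t)|\to0$ as $\delta\downarrow0$. Such an $A$ is unique; write $[x]^p:=A$ and let $\mu^{p,x}$ be the finite nonatomic Borel measure on $[0,T]$ with $\mu^{p,x}([0,t])=[x]^p(t)$. When the limiting function is zero (degenerate case), the notation $[y]^p$ for the limiting energy is still used. First-order remainder energy: writing $\Pi(\ell,a)=\{0=v_0<\dots<v_N=T\}$, $$\mathcal Q_p(y\mid x,g;\ell,a):=\sup_{t\in[0,T]}\sum_{i=0}^{N-1}\left|y(v_{i+1}\wedge t)-y(v_i\wedge t)-g(v_i)\bigl(x(v_{i+1}\wedge t)-x(v_i\wedge t)\bigr)\right|^p.$$ Compensated (Cont–Perkowski) integral for $p$ even along partitions $\lambda_n=\{u^n_i\}$ with vanishing mesh: $\int_0^tf'(x(s))\,\mathrm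 d^{\mathrm{CP}}x(s):=\lim_{n\to\infty}\sum_i\sum_{j=1}^{p-1}\frac{f^{(j)}(x(u^n_i))}{j!}\bigl(x(u^n_{i+1}\wedge t)-x(u^n_i\wedge t)\bigr)^j$. *)

theory Defs
  imports "HOL-Analysis.Analysis"
begin

text \<open>
  Paths on \<open>[0,T]\<close> are functions on \<open>real\<close>; only their values on \<open>{0..T}\<close> matter.
  A partition is the finite set of its points, the \<open>i\<close>-th point \<open>u\<^sub>i\<close> being the \<open>i\<close>-th
  element in increasing order, so that \<open>N = card lam - 1\<close>.
\<close>

definition partition_point :: "real set \<Rightarrow> nat \<Rightarrow> real" where
  "partition_point lam i = sorted_list_of_set lam ! i"

definition mesh :: "real set \<Rightarrow> real" where
  "mesh lam = Max ((\<lambda>i. partition_point lam (Suc i) - partition_point lam i) ` {..<card lam - 1})"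

definition stopped_increment :: "real set \<Rightarrow> (real \<Rightarrow> real) \<Rightarrow> real \<Rightarrow> nat \<Rightarrow> real" where
  "stopped_increment lam x t i =
     x (min (partition_point lam (Suc i)) t) - x (min (partition_point lam i) t)"

definition stopped_energy :: "real \<Rightarrow> real set \<Rightarrow> (real \<Rightarrow> real) \<Rightarrow> real \<Rightarrow> real" where
  "stopped_energy p lam x t = (\<Sum>i<card lam - 1. \<bar>stopped_increment lam x t i\<bar> powr p)"

definition uniform_grid :: "real \<Rightarrow> real \<Rightarrow> real \<Rightarrow> real set" where
  "uniform_grid T l a =
     {0, T} \<union> {a + of_int k * l | k :: int. 0 < a + of_int k * l \<and> a + of_int k * l < T}"

text \<open>
  \<open>vanishes_on_grids T \<Phi>\<close>: the supremum of \<open>\<Phi> l a\<close> over \<open>0 < l \<le> \<delta>\<close> and \<open>0 \<le> a < l\<close>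
  tends to \<open>0\<close> as \<open>\<delta>\<close> decreases to \<open>0\<close>; grids exist only for \<open>l \<le> T\<close>. Suprema are taken in
  \<^typ>\<open>ennreal\<close>, hence are genuine suprema even when infinite.
\<close>

definition vanishes_on_grids :: "real \<Rightarrow> (real \<Rightarrow> real \<Rightarrow> ennreal) \<Rightarrow> bool" where
  "vanishes_on_grids T \<Phi> \<longleftrightarrow>
     ((\<lambda>\<delta>. SUP l\<in>{l. 0 < l \<and> l \<le> \<delta> \<and> l \<le> T}. SUP a\<in>{0..<l}. \<Phi> l a) \<longlongrightarrow> 0) (at_right 0)"

definition energy_converges ::
    "real \<Rightarrow> real \<Rightarrow> (real \<Rightarrow> real) \<Rightarrow> (real \<Rightarrow> real) \<Rightarrow> bool" where
  "energy_converges p T x A \<longleftrightarrow>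
     vanishes_on_grids T (\<lambda>l a. SUP t\<in>{0..T}. ennreal \<bar>stopped_energy p (uniform_grid T l a) x t - A t\<bar>)"

text \<open>All requirements on a \<open>p\<close>-rough path with energy \<open>A\<close> except nondegeneracy \<open>A T > 0\<close>.\<close>

definition has_limiting_energy ::
    "real \<Rightarrow> real \<Rightarrow> (real \<Rightarrow> real) \<Rightarrow> (real \<Rightarrow> real) \<Rightarrow> bool" where
  "has_limiting_energy p T x A \<longleftrightarrow>
     continuous_on {0..T} x \<and> continuous_on {0..T} A \<and> mono_on {0..T} A \<and> A 0 = 0 \<and>
     energy_converges p T x A"

definition rough_paths :: "real \<Rightarrow> real \<Rightarrow> (real \<Rightarrow> real) set" where
  "rough_paths p T = {x. \<exists>A. has_limiting_energy p T x A \<and> A T > 0}"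

text \<open>The choice is unique on \<open>{0..T}\<close>, see \<open>limiting_energy_eq\<close> below; other values are irrelevant.\<close>

definition limiting_energy :: "real \<Rightarrow> real \<Rightarrow> (real \<Rightarrow> real) \<Rightarrow> real \<Rightarrow> real" where
  "limiting_energy p T x = (SOME A. has_limiting_energy p T x A)"

text \<open>
  The Stieltjes measure of the limiting energy, extended by constants outside \<open>{0..T}\<close>, as a
  Borel measure on the space \<open>{0..T}\<close>; see \<open>emeasure_energy_measure\<close> below.
\<close>

definition energy_measure :: "real \<Rightarrow> real \<Rightarrow> (real \<Rightarrow> real) \<Rightarrow> real measure" where
  "energy_measure p T x =
     restrict_space (interval_measure (\<lambda>t. limiting_energy p T x (max 0 (min t T)))) {0..T}"

definition weighted_energy ::
    "real \<Rightarrow> real \<Rightarrow> (real \<Rightarrow> real) \<Rightarrow> (real \<Rightarrow> real) \<Rightarrow> real \<Rightarrow> real" where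
  "weighted_energy p T x g t = (LINT s:{0..t}|energy_measure p T x. \<bar>g s\<bar> powr p)"

definition remainder_energy ::
    "real \<Rightarrow> real \<Rightarrow> (real \<Rightarrow> real) \<Rightarrow> (real \<Rightarrow> real) \<Rightarrow> (real \<Rightarrow> real) \<Rightarrow> real \<Rightarrow> real \<Rightarrow> ennreal" where
  "remainder_energy p T y x g l a =
     (let lam = uniform_grid T l a in
      SUP t\<in>{0..T}. ennreal (\<Sum>i<card lam - 1.
        \<bar>stopped_increment lam y t i - g (partition_point lam i) * stopped_increment lam x t i\<bar> powr p))"

definition remainder_vanishes ::
    "real \<Rightarrow> real \<Rightarrow> (real \<Rightarrow> real) \<Rightarrow> (real \<Rightarrow> real) \<Rightarrow> (real \<Rightarrow> real) \<Rightarrow> bool" where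
  "remainder_vanishes p T y x g \<longleftrightarrow> vanishes_on_grids T (remainder_energy p T y x g)"

definition finite_variation :: "real \<Rightarrow> (real \<Rightarrow> real) \<Rightarrow> bool" where
  "finite_variation T z \<longleftrightarrow>
     (\<exists>C. \<forall>lam. finite lam \<and> {0, T} \<subseteq> lam \<and> lam \<subseteq> {0..T} \<longrightarrow>
        (\<Sum>i<card lam - 1. \<bar>z (partition_point lam (Suc i)) - z (partition_point lam i)\<bar>) \<le> C)"

definition holder_on :: "real \<Rightarrow> real set \<Rightarrow> (real \<Rightarrow> real) \<Rightarrow> bool" where
  "holder_on \<alpha> S z \<longleftrightarrow> (\<exists>C. \<forall>s\<in>S. \<forall>t\<in>S. \<bar>z s - z t\<bar> \<le> C * \<bar>s - t\<bar> powr \<alpha>)"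

definition C_k :: "nat \<Rightarrow> (real \<Rightarrow> real) \<Rightarrow> bool" where
  "C_k k f \<longleftrightarrow> (\<forall>j<k. \<forall>u. (deriv ^^ j) f field_differentiable at u) \<and>
     continuous_on UNIV ((deriv ^^ k) f)"

definition compensated_sum ::
    "nat \<Rightarrow> (real \<Rightarrow> real) \<Rightarrow> (real \<Rightarrow> real) \<Rightarrow> real set \<Rightarrow> real \<Rightarrow> real" where
  "compensated_sum p f x lam t =
     (\<Sum>i<card lam - 1. \<Sum>j = 1..p - 1.
        (deriv ^^ j) f (x (partition_point lam i)) / fact j * stopped_increment lam x t i ^ j)"

text \<open>\<open>I\<close> is the compensated integral of \<open>f' \<circ> x\<close> up to time \<open>t\<close> along the partitions \<open>lam n\<close>.\<close>

definition has_compensated_integral ::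
    "nat \<Rightarrow> (real \<Rightarrow> real) \<Rightarrow> (real \<Rightarrow> real) \<Rightarrow> (nat \<Rightarrow> real set) \<Rightarrow> real \<Rightarrow> real \<Rightarrow> bool" where
  "has_compensated_integral p f x lam t I \<longleftrightarrow>
     (\<lambda>n. compensated_sum p f x (lam n) t) \<longlonglongrightarrow> I"

lemma finite_uniform_grid:
  assumes "0 < l"
  shows "finite (uniform_grid T l a)"
proof -
  have "{a + of_int k * l | k :: int. 0 < a + of_int k * l \<and> a + of_int k * l < T}
      \<subseteq> (\<lambda>k. a + of_int k * l) ` {\<lfloor>- a / l\<rfloor>..\<lceil>(T - a) / l\<rceil>}"
  proof clarify
    fix k :: int assume k: "0 < a + of_int k * l" "a + of_int k * l < T"
    have "- a / l \<le> of_int k" "of_int k \<le> (T - a) / l"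
      using k assms by (simp_all add: field_simps)
    then have "k \<in> {\<lfloor>- a / l\<rfloor>..\<lceil>(T - a) / l\<rceil>}"
      by (auto simp: floor_le_iff le_ceiling_iff)
    then show "a + of_int k * l \<in> (\<lambda>k. a + of_int k * l) ` {\<lfloor>- a / l\<rfloor>..\<lceil>(T - a) / l\<rceil>}"
      by blast
  qed
  then show ?thesis
    unfolding uniform_grid_def by (simp add: finite_subset)
qed

lemma energy_converges_pointwise:
  assumes "0 < T" "energy_converges p T x A" "t \<in> {0..T}"
  shows "((\<lambda>l. stopped_energy p (uniform_grid T l 0) x t) \<longlongrightarrow> A t) (at_right 0)"
proof -
  let ?S = "\<lambda>\<delta>. SUP l\<in>{l. 0 < l \<and> l \<le> \<delta> \<and> l \<le> T}. SUP a\<in>{0..<l}.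
      SUP t\<in>{0..T}. ennreal \<bar>stopped_energy p (uniform_grid T l a) x t - A t\<bar>"
  let ?d = "\<lambda>l. \<bar>stopped_energy p (uniform_grid T l 0) x t - A t\<bar>"
  have S: "(?S \<longlongrightarrow> 0) (at_right 0)"
    using assms(2) by (simp add: energy_converges_def vanishes_on_grids_def)
  have "eventually (\<lambda>l. l \<in> {0<..<T}) (at_right 0)"
    using assms(1) by (rule eventually_at_right_real)
  then have le: "eventually (\<lambda>l. ennreal (?d l) \<le> ?S l) (at_right 0)"
  proof eventually_elim
    case (elim l)
    have "ennreal (?d l) \<le> (SUP t\<in>{0..T}. ennreal \<bar>stopped_energy p (uniform_grid T l 0) x t - A t\<bar>)"
      using assms(3) by (rule SUP_upper)
    also have "\<dots> \<le> (SUP a\<in>{0..<l}. SUP t\<in>{0..T}. ennreal \<bar>stopped_energy p (uniform_grid T l a) x t - A t\<bar>)"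
      using elim by (intro SUP_upper) auto
    also have "\<dots> \<le> ?S l"
      using elim by (intro SUP_upper) auto
    finally show ?case .
  qed
  have "((\<lambda>l. ennreal (?d l)) \<longlongrightarrow> 0) (at_right 0)"
    by (rule tendsto_sandwich[OF _ le tendsto_const S]) simp
  then have "((\<lambda>l. ennreal (?d l)) \<longlongrightarrow> ennreal 0) (at_right 0)"
    by simp
  then have "(?d \<longlongrightarrow> 0) (at_right 0)"
    by (subst (asm) tendsto_ennreal_iff) auto
  then show ?thesis
    using LIM_zero_cancel tendsto_rabs_zero_iff by blast
qed

lemma has_limiting_energy_unique:
  assumes "0 < T" "has_limiting_energy p T x A" "has_limiting_energy p T x B" "t \<in> {0..T}"
  shows "A t = B t"
  using energy_converges_pointwise[OF assms(1) _ assms(4)] assms(2,3)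
  unfolding has_limiting_energy_def
  by (meson tendsto_unique trivial_limit_at_right_real)

lemma has_limiting_energy_limiting_energy:
  assumes "has_limiting_energy p T x A"
  shows "has_limiting_energy p T x (limiting_energy p T x)"
  using someI[of "has_limiting_energy p T x", OF assms] by (simp add: limiting_energy_def)

lemma limiting_energy_eq:
  assumes "0 < T" "has_limiting_energy p T x A" "t \<in> {0..T}"
  shows "limiting_energy p T x t = A t"
  using has_limiting_energy_unique has_limiting_energy_limiting_energy assms by metis

lemma emeasure_energy_measure:
  assumes "0 < T" "has_limiting_energy p T x A" "t \<in> {0..T}"
  shows "emeasure (energy_measure p T x) {0..t} = ennreal (A t)"
proof -
  let ?E = "limiting_energy p T x" and ?c = "\<lambda>t. max 0 (min t T)"
  have E: "has_limiting_energy p T x ?E"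
    using has_limiting_energy_limiting_energy[OF assms(2)] .
  have c: "?c u \<in> {0..T}" for u
    using assms(1) by auto
  have mono: "?E (?c u) \<le> ?E (?c v)" if "u \<le> v" for u v
    using E that c unfolding has_limiting_energy_def
    by (intro mono_onD[of "{0..T}" ?E]) auto
  have "continuous_on UNIV (\<lambda>u. ?E (?c u))"
    using E c unfolding has_limiting_energy_def
    by (intro continuous_on_compose2[of "{0..T}" ?E UNIV ?c] continuous_intros) auto
  then have "emeasure (interval_measure (\<lambda>u. ?E (?c u))) {0..t} = ennreal (?E (?c t) - ?E (?c 0))"
    using assms(3) mono by (intro emeasure_interval_measure_Icc) auto
  also have "\<dots> = ennreal (A t)"
    using assms E limiting_energy_eq[OF assms] by (simp add: has_limiting_energy_def)
  finally show ?thesis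
    unfolding energy_measure_def
    using assms(3) by (subst emeasure_restrict_space) auto
qed

end

theory Submission
  imports Defs
begin

text \<open>
  On a grid with points \<open>v\<^sub>i\<close>, condition \<open>(*)\<close> says that the increments of \<open>y\<close> are
  \<open>g(v\<^sub>i)\<close> times those of \<open>x\<close> up to an error that is negligible in \<open>l\<^sup>p\<close>, so the energy of
  \<open>y\<close> has the same limit as the sums of \<open>|g(v\<^sub>i)|\<^sup>p |\<Delta>\<^sub>i x|\<^sup>p\<close>. For a Lipschitz weight \<open>h\<close>
  summation by parts bounds the difference between the sums of \<open>h(v\<^sub>i) |\<Delta>\<^sub>i x|\<^sup>p\<close> and of
  \<open>h(v\<^sub>i) \<Delta>\<^sub>i A\<close> by the uniform distance of the stopped energy of \<open>x\<close> from its limit \<open>A\<close>;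
  continuous weights follow by Weierstrass approximation, and the second sums are Riemann-Stieltjes
  sums. For \<open>F \<circ> x\<close> condition \<open>(*)\<close> is the mean value theorem. Taylor's formula identifies the
  compensated integral, whose \<open>\<mu>\<close>-integral term has finite variation and hence no \<open>p\<close>-energy.
\<close>

section \<open>Partitions and shifted grids\<close>

text \<open>The weight \<open>\<bar>g s\<bar> powr p\<close> is only continuous, so its variation
  along the grids may grow without bound under refinement, while summation by parts pays exactly
  that variation times the uniform energy error. A Lipschitz weight has variation at most
  \<open>L * T\<close> on every grid, and passing to it costs its uniform distance from the original
  times total energies, which stay bounded. Uniformity in \<open>t\<close> supplies the partial
  sums, because truncating a stopped sum amounts to stopping earlier. The measure enters the
  convergence argument only through \<open>stieltjes_primitive\<close>; that argument admits weights
  of either sign, as the compensated integral requires for the derivative of order \<open>q\<close>.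
  Estimates are uniform over all grids of small step and are therefore phrased as
  \<open>uniform_limit\<close> along a single filter, so that limits along sequences of grids follow
  by composition.\<close>

locale time_partition =
  fixes T :: real and lam :: "real set"
  assumes finite_points: "finite lam" and endpoints: "{0, T} \<subseteq> lam" and points_subset: "lam \<subseteq> {0..T}"
begin

lemma card_pos: "0 < card lam"
  using finite_points endpoints by (auto simp: card_gt_0_iff)

lemma point_less_iff:
  assumes "i < card lam" "j < card lam"
  shows "partition_point lam i < partition_point lam j \<longleftrightarrow> i < j"
proof -
  have *: "partition_point lam m < partition_point lam n" if "m < n" "n < card lam" for m n
    unfolding partition_point_def
    using that by (intro sorted_wrt_nth_less[OF strict_sorted_list_of_set]) auto
  show ?thesis
    using *[of i j] *[of j i] assms by (metis less_asym linorder_neqE_nat)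
qed

lemma point_mono:
  assumes "i \<le> j" "j < card lam"
  shows "partition_point lam i \<le> partition_point lam j"
  using point_less_iff[of j i] assms by (simp add: leI)

lemma point_in_partition:
  assumes "i < card lam"
  shows "partition_point lam i \<in> lam"
  using assms finite_points unfolding partition_point_def
  by (metis length_sorted_list_of_set nth_mem set_sorted_list_of_set)

lemma point_in_interval:
  assumes "i < card lam"
  shows "partition_point lam i \<in> {0..T}"
  using point_in_partition[OF assms] points_subset by blast

lemma obtain_index:
  assumes "c \<in> lam"
  obtains j where "j < card lam" "partition_point lam j = c"
  using assms finite_points unfolding partition_point_def
  by (metis in_set_conv_nth length_sorted_list_of_set set_sorted_list_of_set)

lemma point_0: "partition_point lam 0 = 0"
proof -
  obtain j where j: "j < card lam" "partition_point lam j = 0"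
    using obtain_index[of 0] endpoints by auto
  show ?thesis
    using point_mono[of 0 j] point_in_interval[of 0] j card_pos by auto
qed

lemma point_last: "partition_point lam (card lam - 1) = T"
proof -
  obtain j where j: "j < card lam" "partition_point lam j = T"
    using obtain_index[of T] endpoints by auto
  show ?thesis
    using point_mono[of j "card lam - 1"] point_in_interval[of "card lam - 1"] j card_pos by auto
qed

lemma no_point_between:
  assumes "Suc i < card lam" "c \<in> lam" "partition_point lam i < c" "c < partition_point lam (Suc i)"
  shows False
proof -
  obtain j where "j < card lam" "partition_point lam j = c"
    using obtain_index assms(2) .
  then show False
    using point_less_iff[of i j] point_less_iff[of j "Suc i"] assms by auto
qed

lemma sum_stopped_differences:
  fixes F :: "real \<Rightarrow> real"
  assumes "t \<in> {0..T}"
  shows "(\<Sum>i<card lam - 1. F (min (partition_point lam (Suc i)) t) - F (min (partition_point lam i) t)) = F t - F 0"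
  using assms sum_lessThan_telescope[of "\<lambda>i. F (min (partition_point lam i) t)" "card lam - 1"]
  by (simp add: point_0 point_last[simplified] min_absorb2)

lemma sum_gaps: "(\<Sum>i<card lam - 1. partition_point lam (Suc i) - partition_point lam i) = T"
  using sum_lessThan_telescope[of "partition_point lam" "card lam - 1"] by (simp add: point_0 point_last[simplified])

lemma stopped_points:
  assumes "i < card lam - 1" "t \<in> {0..T}"
  shows "min (partition_point lam i) t \<in> {0..T}" "min (partition_point lam (Suc i)) t \<in> {0..T}"
    "min (partition_point lam i) t \<le> min (partition_point lam (Suc i)) t"
    "min (partition_point lam (Suc i)) t - min (partition_point lam i) t
      \<le> partition_point lam (Suc i) - partition_point lam i"
proof -
  have "partition_point lam i \<in> {0..T}" "partition_point lam (Suc i) \<in> {0..T}"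
    "partition_point lam i \<le> partition_point lam (Suc i)"
    using point_in_interval[of i] point_in_interval[of "Suc i"] point_mono[of i "Suc i"] assms(1) card_pos
    by linarith+
  then show "min (partition_point lam i) t \<in> {0..T}" "min (partition_point lam (Suc i)) t \<in> {0..T}"
    "min (partition_point lam i) t \<le> min (partition_point lam (Suc i)) t"
    "min (partition_point lam (Suc i)) t - min (partition_point lam i) t
      \<le> partition_point lam (Suc i) - partition_point lam i"
    using assms(2) by (auto simp: min_def)
qed

text \<open>
  Stopping at the smaller of \<open>t\<close> and the \<open>k\<close>-th point truncates the sum, so all partial sums
  of a stopped energy are again stopped energies, uniformly controlled by convergence in \<open>t\<close>.
\<close>

lemma partial_energy:
  assumes "k \<le> card lam - 1"
  shows "(\<Sum>i<k. \<bar>stopped_increment lam x t i\<bar> powr p) = stopped_energy p lam x (min (partition_point lam k) t)"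
proof -
  have "stopped_energy p lam x (min (partition_point lam k) t)
      = (\<Sum>i<card lam - 1. if i < k then \<bar>stopped_increment lam x t i\<bar> powr p else 0)"
    unfolding stopped_energy_def
  proof (intro sum.cong refl)
    fix i assume i: "i \<in> {..<card lam - 1}"
    show "\<bar>stopped_increment lam x (min (partition_point lam k) t) i\<bar> powr p
        = (if i < k then \<bar>stopped_increment lam x t i\<bar> powr p else 0)"
    proof (cases "i < k")
      case True
      then have "partition_point lam i \<le> partition_point lam k" "partition_point lam (Suc i) \<le> partition_point lam k"
        using assms card_pos by (auto intro!: point_mono)
      then have "min (partition_point lam i) (min (partition_point lam k) t) = min (partition_point lam i) t"
        "min (partition_point lam (Suc i)) (min (partition_point lam k) t) = min (partition_point lam (Suc i)) t"
        by auto
      then show ?thesis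
        using True by (simp add: stopped_increment_def)
    next
      case False
      then have "partition_point lam k \<le> partition_point lam i" "partition_point lam k \<le> partition_point lam (Suc i)"
        using i by (auto intro!: point_mono)
      then have "min (partition_point lam i) (min (partition_point lam k) t) = min (partition_point lam k) t"
        "min (partition_point lam (Suc i)) (min (partition_point lam k) t) = min (partition_point lam k) t"
        by auto
      then show ?thesis
        using False by (simp add: stopped_increment_def)
    qed
  qed
  also have "\<dots> = (\<Sum>i<k. \<bar>stopped_increment lam x t i\<bar> powr p)"
    using assms by (subst sum.inter_restrict[symmetric, where B="{..<k}", simplified]) (auto intro!: sum.cong)
  finally show ?thesis ..
qed

text \<open>Counterpart of \<open>partial_energy\<close> for the limit: subtracting the two turns
  every partial sum of energy minus clock increments into one value of the stopped energy minus
  \<open>A\<close>, which is uniformly small.\<close>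

lemma partial_clock:
  assumes "k \<le> card lam - 1" "0 \<le> t"
  shows "(\<Sum>i<k. stopped_increment lam A t i) = A (min (partition_point lam k) t) - A 0"
  using assms sum_lessThan_telescope[of "\<lambda>i. A (min (partition_point lam i) t)" k]
  by (simp add: stopped_increment_def point_0)

lemma gap_le_mesh:
  assumes "i < card lam - 1"
  shows "partition_point lam (Suc i) - partition_point lam i \<le> mesh lam"
  unfolding mesh_def using assms by (intro Max_ge) auto

end

section \<open>Gaps and mesh of shifted uniform grids\<close>

lemma time_partition_uniform_grid:
  assumes "0 \<le> T" "0 < l"
  shows "time_partition T (uniform_grid T l a)"
  using assms finite_uniform_grid[of l T a] by unfold_locales (auto simp: uniform_grid_def)

text \<open>A longer gap would contain a lattice point strictly inside it, and that point would
  belong to the grid. The added endpoints \<open>0\<close> and \<open>T\<close> can only shorten the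
  extreme gaps.\<close>

lemma uniform_grid_gap_le:
  assumes "0 \<le> T" "0 < l" "i < card (uniform_grid T l a) - 1"
  shows "partition_point (uniform_grid T l a) (Suc i) - partition_point (uniform_grid T l a) i \<le> l"
proof (rule ccontr)
  interpret time_partition T "uniform_grid T l a"
    using assms by (intro time_partition_uniform_grid)
  let ?v = "partition_point (uniform_grid T l a)"
  assume "\<not> ?thesis"
  then have gap: "?v i + l < ?v (Suc i)"
    by simp
  \<comment> \<open>The first lattice point strictly to the right of \<open>?v i\<close>; floor plus
    one instead of a ceiling, since \<open>?v i\<close> may itself lie on the lattice.\<close>
  define k where "k = \<lfloor>(?v i - a) / l\<rfloor> + 1"
  have "(?v i - a) / l < of_int k" "of_int k \<le> (?v i - a) / l + 1"
    unfolding k_def by linarith+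
  then have k: "?v i < a + of_int k * l" "a + of_int k * l \<le> ?v i + l"
    using assms(2) by (simp_all add: field_simps)
  have "0 \<le> ?v i" "?v (Suc i) \<le> T"
    using point_in_interval[of i] point_in_interval[of "Suc i"] assms(3) by auto
  then have "0 < a + of_int k * l" "a + of_int k * l < T"
    using k gap by linarith+
  then have "a + of_int k * l \<in> uniform_grid T l a"
    unfolding uniform_grid_def by blast
  moreover have "a + of_int k * l < ?v (Suc i)" "Suc i < card (uniform_grid T l a)"
    using k gap assms(3) by linarith+
  ultimately show False
    using no_point_between[of i "a + of_int k * l"] k(1) by blast
qed

text \<open>
  If \<open>mesh\<close> were below \<open>l / 2\<close>, the first two points after \<open>0\<close> would be interior lattice points
  at distance less than \<open>l\<close>.
\<close>

lemma le_mesh_uniform_grid: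
  assumes "0 < l" "l \<le> T"
  shows "l \<le> 2 * mesh (uniform_grid T l a)"
proof (rule ccontr)
  interpret time_partition T "uniform_grid T l a"
    using assms by (intro time_partition_uniform_grid) auto
  let ?G = "uniform_grid T l a"
  let ?v = "partition_point ?G"
  assume "\<not> ?thesis"
  then have m: "2 * mesh ?G < l" by simp
  have lattice: "\<exists>k :: int. c = a + of_int k * l" if "c \<in> ?G" "0 < c" "c < T" for c
    using that unfolding uniform_grid_def by auto
  have 1: "0 < card ?G - 1"
    using point_0 point_last assms by (cases "card ?G - 1") auto
  have v1: "0 < ?v 1" "?v 1 \<le> mesh ?G"
    using gap_le_mesh[OF 1] point_less_iff[of 0 1] 1 by (auto simp: point_0)
  then have "?v 1 < T" using m assms by linarith
  then have 2: "1 < card ?G - 1"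
    using point_last 1 by (cases "card ?G - 1 = 1") auto
  have v2: "?v 1 < ?v 2" "?v 2 - ?v 1 \<le> mesh ?G"
    using gap_le_mesh[OF 2] point_less_iff[of 1 2] 2 by (auto simp: numeral_2_eq_2)
  then have "?v 2 < T" using v1 m assms by linarith
  obtain j k :: int where "?v 1 = a + of_int j * l" "?v 2 = a + of_int k * l"
    using lattice[of "?v 1"] lattice[of "?v 2"] point_in_partition[of 1] point_in_partition[of 2]
      v1 v2 \<open>?v 1 < T\<close> \<open>?v 2 < T\<close> 2 by auto
  then have "0 < of_int (k - j) * l" "of_int (k - j) * l < 1 * l"
    using v1 v2 m by (auto simp: algebra_simps)
  then have "0 < k - j" "k - j < 1"
    using assms(1) by (simp_all only: mult_less_cancel_right zero_less_mult_iff of_int_0_less_iff) auto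
  then show False by simp
qed

text \<open>
  Convergence along this filter, uniformly in \<open>t\<close>, is the vanishing of the suprema over all grids
  of step at most \<open>\<delta>\<close> as \<open>\<delta>\<close> decreases to \<open>0\<close>.
\<close>

definition fine_grids :: "real \<Rightarrow> real set filter" where
  "fine_grids T = filtermap (\<lambda>(l, a). uniform_grid T l a)
     (inf (filtercomap fst (at_right 0)) (principal {(l, a). l \<le> T \<and> 0 \<le> a \<and> a < l}))"

lemma eventually_fine_grids:
  "eventually P (fine_grids T) \<longleftrightarrow>
     (\<exists>d>0. \<forall>l a. 0 < l \<and> l \<le> d \<and> l \<le> T \<and> 0 \<le> a \<and> a < l \<longrightarrow> P (uniform_grid T l a))"
proof -
  let ?P = "\<lambda>l a. l \<le> T \<and> 0 \<le> a \<and> a < l \<longrightarrow> P (uniform_grid T l a)"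
  have "eventually P (fine_grids T) \<longleftrightarrow> eventually (\<lambda>l. \<forall>a. ?P l a) (at_right 0)"
    unfolding fine_grids_def eventually_filtermap eventually_inf_principal eventually_filtercomap
    by (rule iffI, (elim exE conjE, erule eventually_mono, force), (intro exI conjI, assumption, simp))
  also have "\<dots> \<longleftrightarrow> (\<exists>d>0. \<forall>l a. 0 < l \<and> l \<le> d \<longrightarrow> ?P l a)"
  proof
    assume "eventually (\<lambda>l. \<forall>a. ?P l a) (at_right 0)"
    then obtain b where b: "0 < b" "\<And>l. 0 < l \<Longrightarrow> l < b \<Longrightarrow> \<forall>a. ?P l a"
      unfolding eventually_at_right_field by blast
    \<comment> \<open>\<open>at_right 0\<close> controls only \<open>l < b\<close>, whereas the step
      \<open>l = d\<close> is included on the left; halving \<open>b\<close> absorbs the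
      difference.\<close>
    have "0 < l \<and> l \<le> b / 2 \<longrightarrow> ?P l a" for l a
    proof
      assume "0 < l \<and> l \<le> b / 2"
      then have "0 < l" "l < b" using b(1) by linarith+
      then show "?P l a" using b(2) by blast
    qed
    then show "\<exists>d>0. \<forall>l a. 0 < l \<and> l \<le> d \<longrightarrow> ?P l a"
      using half_gt_zero[OF b(1)] by blast
  next
    assume "\<exists>d>0. \<forall>l a. 0 < l \<and> l \<le> d \<longrightarrow> ?P l a"
    then show "eventually (\<lambda>l. \<forall>a. ?P l a) (at_right 0)"
      unfolding eventually_at_right_field by (meson less_imp_le)
  qed
  finally show ?thesis
    by (simp only: imp_conjL imp_conjR)
qed

text \<open>The supremum over steps up to \<open>\<delta>\<close> increases with
  \<open>\<delta>\<close>, so a bound at one \<open>\<delta>\<close> serves all smaller ones. This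
  replaces nested extended-real suprema by an eventual bound with real \<open>e\<close>.\<close>

lemma vanishes_on_grids_iff:
  "vanishes_on_grids T (\<lambda>l a. \<Phi> (uniform_grid T l a)) \<longleftrightarrow> (\<forall>e>0. \<forall>\<^sub>F lam in fine_grids T. \<Phi> lam \<le> ennreal e)"
    (is "?L \<longleftrightarrow> ?R")
proof -
  let ?S = "\<lambda>\<delta>. SUP l\<in>{l. 0 < l \<and> l \<le> \<delta> \<and> l \<le> T}. SUP a\<in>{0..<l}. \<Phi> (uniform_grid T l a)"
  show ?thesis
  proof
    assume L: ?L
    show ?R
    proof (intro allI impI)
      fix e :: real assume "0 < e"
      then have "eventually (\<lambda>\<delta>. ?S \<delta> < ennreal e) (at_right 0)"
        using L unfolding vanishes_on_grids_def by (intro order_tendstoD) auto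
      then obtain b where b: "0 < b" "\<And>\<delta>. 0 < \<delta> \<Longrightarrow> \<delta> < b \<Longrightarrow> ?S \<delta> < ennreal e"
        unfolding eventually_at_right_field by blast
      show "\<forall>\<^sub>F lam in fine_grids T. \<Phi> lam \<le> ennreal e"
        unfolding eventually_fine_grids
      proof (intro exI[of _ "b / 2"] conjI allI impI)
        fix l a assume la: "0 < l \<and> l \<le> b / 2 \<and> l \<le> T \<and> 0 \<le> a \<and> a < l"
        have "\<Phi> (uniform_grid T l a) \<le> (SUP a\<in>{0..<l}. \<Phi> (uniform_grid T l a))"
          using la by (intro SUP_upper) auto
        also have "\<dots> \<le> ?S (b / 2)"
          using la by (intro SUP_upper) auto
        also have "\<dots> \<le> ennreal e"
          using b(1) by (intro less_imp_le b(2)) auto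
        finally show "\<Phi> (uniform_grid T l a) \<le> ennreal e" .
      qed (use b in auto)
    qed
  next
    assume R: ?R
    show ?L
      unfolding vanishes_on_grids_def
    proof (rule order_tendstoI)
      fix c :: ennreal assume "0 < c"
      \<comment> \<open>\<open>c\<close> may be infinite, and a strict bound does not survive a
        supremum; a real value strictly between \<open>0\<close> and \<open>c\<close> resolves
        both.\<close>
      then obtain r where r: "0 < r" "r < c" by (rule dense[THEN exE]) blast
      then obtain e where "r = ennreal e" by (cases r) auto
      with r have e: "0 < e" "ennreal e < c" by auto
      have "\<forall>\<^sub>F lam in fine_grids T. \<Phi> lam \<le> ennreal e"
        using R e(1) by simp
      then obtain d where d: "0 < d"
        "\<forall>l a. 0 < l \<and> l \<le> d \<and> l \<le> T \<and> 0 \<le> a \<and> a < l \<longrightarrow> \<Phi> (uniform_grid T l a) \<le> ennreal e"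
        unfolding eventually_fine_grids by (elim exE conjE)
      have "?S \<delta> < c" if "0 < \<delta>" "\<delta> < d" for \<delta>
      proof -
        have "?S \<delta> \<le> ennreal e"
        proof (intro SUP_least d(2)[rule_format])
          fix l a assume "l \<in> {l. 0 < l \<and> l \<le> \<delta> \<and> l \<le> T}" "a \<in> {0..<l}"
          with that show "0 < l \<and> l \<le> d \<and> l \<le> T \<and> 0 \<le> a \<and> a < l"
            by simp
        qed
        then show ?thesis using e(2) by (rule le_less_trans)
      qed
      then show "eventually (\<lambda>\<delta>. ?S \<delta> < c) (at_right 0)"
        by (intro eventually_at_rightI[OF _ d(1)]) simp
    next
      fix c :: ennreal assume "c < 0"
      then show "eventually (\<lambda>\<delta>. c < ?S \<delta>) (at_right 0)"
        by (meson not_less_zero)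
    qed
  qed
qed

text \<open>The supremum over \<open>t\<close> yields non-strict bounds and
  \<open>uniform_limit\<close> asks for strict ones; since \<open>e\<close> is arbitrary, halving it
  reconciles them. From here on all grid statements are handled in the form on the right.\<close>

lemma vanishes_on_grids_uniform_limit:
  "vanishes_on_grids T (\<lambda>l a. SUP t\<in>{0..T}. ennreal \<bar>\<phi> (uniform_grid T l a) t - \<psi> t\<bar>)
    \<longleftrightarrow> uniform_limit {0..T} \<phi> \<psi> (fine_grids T)"
proof -
  have *: "(SUP t\<in>{0..T}. ennreal \<bar>\<phi> lam t - \<psi> t\<bar>) \<le> ennreal e \<longleftrightarrow> (\<forall>t\<in>{0..T}. \<bar>\<phi> lam t - \<psi> t\<bar> \<le> e)"
    if "0 < e" for lam e
    using that by (simp add: SUP_le_iff ennreal_le_iff)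
  have "(\<forall>e>0. \<forall>\<^sub>F lam in fine_grids T. (SUP t\<in>{0..T}. ennreal \<bar>\<phi> lam t - \<psi> t\<bar>) \<le> ennreal e)
      \<longleftrightarrow> (\<forall>e>0. \<forall>\<^sub>F lam in fine_grids T. \<forall>t\<in>{0..T}. \<bar>\<phi> lam t - \<psi> t\<bar> \<le> e)"
    using * by simp
  also have "\<dots> \<longleftrightarrow> (\<forall>e>0. \<forall>\<^sub>F lam in fine_grids T. \<forall>t\<in>{0..T}. \<bar>\<phi> lam t - \<psi> t\<bar> < e)" (is "?A \<longleftrightarrow> ?B")
  proof
    assume A: ?A
    show ?B
    proof (intro allI impI)
      fix e :: real assume "0 < e"
      then have "\<forall>\<^sub>F lam in fine_grids T. \<forall>t\<in>{0..T}. \<bar>\<phi> lam t - \<psi> t\<bar> \<le> e / 2"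
        using A half_gt_zero by blast
      then show "\<forall>\<^sub>F lam in fine_grids T. \<forall>t\<in>{0..T}. \<bar>\<phi> lam t - \<psi> t\<bar> < e"
        by eventually_elim (use \<open>0 < e\<close> in fastforce)
    qed
  next
    assume B: ?B
    show ?A
    proof (intro allI impI)
      fix e :: real assume "0 < e"
      then have "\<forall>\<^sub>F lam in fine_grids T. \<forall>t\<in>{0..T}. \<bar>\<phi> lam t - \<psi> t\<bar> < e"
        using B by simp
      then show "\<forall>\<^sub>F lam in fine_grids T. \<forall>t\<in>{0..T}. \<bar>\<phi> lam t - \<psi> t\<bar> \<le> e"
        by eventually_elim (auto intro: less_imp_le)
    qed
  qed
  finally show ?thesis
    unfolding uniform_limit_iff dist_real_def
    by (subst vanishes_on_grids_iff[where \<Phi>="\<lambda>lam. SUP t\<in>{0..T}. ennreal \<bar>\<phi> lam t - \<psi> t\<bar>"])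
qed

lemma energy_converges_iff:
  "energy_converges p T x A \<longleftrightarrow> uniform_limit {0..T} (\<lambda>lam. stopped_energy p lam x) A (fine_grids T)"
  unfolding energy_converges_def by (rule vanishes_on_grids_uniform_limit)

lemma remainder_vanishes_iff:
  "remainder_vanishes p T y x g \<longleftrightarrow>
     uniform_limit {0..T} (\<lambda>lam t. \<Sum>i<card lam - 1.
       \<bar>stopped_increment lam y t i - g (partition_point lam i) * stopped_increment lam x t i\<bar> powr p)
       (\<lambda>t. 0) (fine_grids T)"
  unfolding vanishes_on_grids_uniform_limit[symmetric] remainder_vanishes_def remainder_energy_def[abs_def] Let_def
  by (simp add: sum_nonneg abs_of_nonneg)

lemma eventually_partition_fine_grids:
  assumes "0 < T"
  shows "\<forall>\<^sub>F lam in fine_grids T. time_partition T lam"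
  unfolding eventually_fine_grids using assms time_partition_uniform_grid by (auto intro!: exI[of _ 1])

lemma eventually_gap_fine_grids:
  assumes "0 < T" "0 < d"
  shows "\<forall>\<^sub>F lam in fine_grids T. \<forall>i<card lam - 1. partition_point lam (Suc i) - partition_point lam i < d"
  unfolding eventually_fine_grids
proof (intro exI[of _ "d / 2"] conjI allI impI)
  fix l a i assume la: "0 < l \<and> l \<le> d / 2 \<and> l \<le> T \<and> 0 \<le> a \<and> a < l" and "i < card (uniform_grid T l a) - 1"
  then have "partition_point (uniform_grid T l a) (Suc i) - partition_point (uniform_grid T l a) i \<le> l"
    using assms by (intro uniform_grid_gap_le) auto
  then show "partition_point (uniform_grid T l a) (Suc i) - partition_point (uniform_grid T l a) i < d"
    using la assms by linarith
qed (use assms in auto)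

text \<open>Compensated integrals are taken along vanishing mesh, while \<open>fine_grids\<close>
  measures the step \<open>l\<close>; the bound of \<open>l\<close> by twice the mesh connects the
  two.\<close>

lemma filterlim_uniform_grid_mesh:
  assumes "\<And>n. 0 < l n \<and> l n \<le> T \<and> 0 \<le> a n \<and> a n < l n"
    and "(\<lambda>n. mesh (uniform_grid T (l n) (a n))) \<longlonglongrightarrow> 0"
  shows "filterlim (\<lambda>n. uniform_grid T (l n) (a n)) (fine_grids T) sequentially"
  unfolding filterlim_iff eventually_fine_grids
proof clarify
  fix P d assume d: "0 < d"
    and P: "\<forall>l a. 0 < l \<and> l \<le> d \<and> l \<le> T \<and> 0 \<le> a \<and> a < l \<longrightarrow> P (uniform_grid T l a)"
  have "\<forall>\<^sub>F n in sequentially. mesh (uniform_grid T (l n) (a n)) < d / 2"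
    using d by (intro order_tendstoD(2)[OF assms(2)]) simp
  then show "\<forall>\<^sub>F n in sequentially. P (uniform_grid T (l n) (a n))"
  proof eventually_elim
    case (elim n)
    have "l n \<le> 2 * mesh (uniform_grid T (l n) (a n))"
      using assms(1)[of n] by (intro le_mesh_uniform_grid) auto
    then show ?case
      using P assms(1)[of n] elim by auto
  qed
qed

section \<open>Weighted energies\<close>

text \<open>Abel summation: the price is the variation of \<open>c\<close>, not the number of terms.
  The coefficient \<open>c n\<close> lies one past the summation range; in the application it is the
  weight at the final time \<open>T\<close>.\<close>

lemma summation_by_parts_bound:
  fixes c d :: "nat \<Rightarrow> real"
  assumes "\<And>k. k \<le> n \<Longrightarrow> \<bar>\<Sum>i<k. d i\<bar> \<le> E"
  shows "\<bar>\<Sum>i<n. c i * d i\<bar> \<le> (\<bar>c n\<bar> + (\<Sum>i<n. \<bar>c (Suc i) - c i\<bar>)) * E"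
proof -
  have parts: "(\<Sum>i<n. c i * d i) = c n * (\<Sum>i<n. d i) - (\<Sum>i<n. (c (Suc i) - c i) * (\<Sum>j<Suc i. d j))"
    by (induction n) (simp_all add: algebra_simps)
  have "\<bar>\<Sum>i<n. c i * d i\<bar>
      \<le> \<bar>c n * (\<Sum>i<n. d i)\<bar> + \<bar>\<Sum>i<n. (c (Suc i) - c i) * (\<Sum>j<Suc i. d j)\<bar>"
    unfolding parts by (rule abs_triangle_ineq4)
  also have "\<dots> \<le> \<bar>c n\<bar> * E + (\<Sum>i<n. \<bar>c (Suc i) - c i\<bar> * E)"
  proof (rule add_mono)
    show "\<bar>c n * (\<Sum>i<n. d i)\<bar> \<le> \<bar>c n\<bar> * E"
      unfolding abs_mult using assms[of n] by (intro mult_left_mono) auto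
    have "\<bar>\<Sum>i<n. (c (Suc i) - c i) * (\<Sum>j<Suc i. d j)\<bar> \<le> (\<Sum>i<n. \<bar>(c (Suc i) - c i) * (\<Sum>j<Suc i. d j)\<bar>)"
      by (rule sum_abs)
    also have "\<dots> \<le> (\<Sum>i<n. \<bar>c (Suc i) - c i\<bar> * E)"
      unfolding abs_mult using assms by (intro sum_mono mult_left_mono) (auto simp del: sum.lessThan_Suc)
    finally show "\<bar>\<Sum>i<n. (c (Suc i) - c i) * (\<Sum>j<Suc i. d j)\<bar> \<le> (\<Sum>i<n. \<bar>c (Suc i) - c i\<bar> * E)" .
  qed
  finally show ?thesis
    by (simp add: sum_distrib_right distrib_right)
qed

text \<open>A Weierstrass polynomial is Lipschitz on a compact interval because its derivative is
  bounded there.\<close>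

lemma lipschitz_approximation:
  fixes h :: "real \<Rightarrow> real"
  assumes "continuous_on {a..b} h" "0 < e"
  obtains L k where "0 \<le> L" "\<forall>s\<in>{a..b}. \<bar>h s - k s\<bar> < e"
    "\<forall>s\<in>{a..b}. \<forall>t\<in>{a..b}. \<bar>k s - k t\<bar> \<le> L * \<bar>s - t\<bar>"
proof -
  obtain k where k: "real_polynomial_function k" "\<And>s. s \<in> {a..b} \<Longrightarrow> \<bar>h s - k s\<bar> < e"
    using Stone_Weierstrass_real_polynomial_function[OF compact_Icc assms] by blast
  obtain k' where k': "real_polynomial_function k'" "\<And>s. (k has_real_derivative k' s) (at s)"
    using has_real_derivative_polynomial_function[OF k(1)] by blast
  have "continuous_on {a..b} k'"
    using k'(1) by (intro continuous_on_polymonial_function) (simp add: real_polynomial_function_eq)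
  then have "bounded (k' ` {a..b})"
    by (intro compact_imp_bounded compact_continuous_image) auto
  then obtain L where L: "0 < L" "\<And>s. s \<in> {a..b} \<Longrightarrow> \<bar>k' s\<bar> \<le> L"
    unfolding bounded_pos by auto
  have "\<bar>k s - k t\<bar> \<le> L * \<bar>s - t\<bar>" if "s \<in> {a..b}" "t \<in> {a..b}" for s t
    using field_differentiable_bound[of "{a..b}" k k' L s t] k'(2) L that
    by (auto intro: has_field_derivative_at_within)
  then show ?thesis
    using L(1) k(2) by (intro that[of L k]) auto
qed

lemma continuous_on_compact_modulus:
  fixes h :: "real \<Rightarrow> real"
  assumes "continuous_on X h" "compact X" "0 < e"
  obtains d where "0 < d" "\<forall>s\<in>X. \<forall>t\<in>X. \<bar>t - s\<bar> < d \<longrightarrow> \<bar>h t - h s\<bar> < e"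
proof -
  have "\<exists>d>0. \<forall>s\<in>X. \<forall>t\<in>X. \<bar>t - s\<bar> < d \<longrightarrow> \<bar>h t - h s\<bar> < e"
    using compact_uniformly_continuous[OF assms(1,2)] assms(3)
    by (simp add: uniformly_continuous_on_def dist_real_def)
  then show ?thesis using that by blast
qed

lemma uniform_limit_bounded_eventually:
  fixes S :: "'a \<Rightarrow> 'b \<Rightarrow> real"
  assumes "uniform_limit X S B F" "\<And>t. t \<in> X \<Longrightarrow> B t \<le> M"
  shows "\<forall>\<^sub>F n in F. \<forall>t\<in>X. S n t \<le> M + 1"
proof -
  have "\<forall>\<^sub>F n in F. \<forall>t\<in>X. dist (S n t) (B t) < 1"
    using assms(1) by (rule uniform_limitD) simp
  then show ?thesis
  proof eventually_elim
    case (elim n)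
    show ?case
    proof
      fix t assume "t \<in> X"
      then have "\<bar>S n t - B t\<bar> < 1" "B t \<le> M"
        using elim assms(2) by (auto simp: dist_real_def)
      then show "S n t \<le> M + 1" by linarith
    qed
  qed
qed

text \<open>
  \<open>B\<close> is the indefinite Stieltjes integral of \<open>h\<close> with respect to \<open>A\<close>, in the form of the
  mean value estimate that characterizes it for continuous \<open>h\<close>.
\<close>

definition stieltjes_primitive ::
    "real \<Rightarrow> (real \<Rightarrow> real) \<Rightarrow> (real \<Rightarrow> real) \<Rightarrow> (real \<Rightarrow> real) \<Rightarrow> bool" where
  "stieltjes_primitive T A h B \<longleftrightarrow> B 0 = 0 \<and>
     (\<forall>s t c e. 0 \<le> s \<and> s \<le> t \<and> t \<le> T \<and> (\<forall>u\<in>{s..t}. \<bar>h u - c\<bar> \<le> e) \<longrightarrow>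
       \<bar>B t - B s - c * (A t - A s)\<bar> \<le> e * (A t - A s))"

lemma stieltjes_primitiveD:
  assumes "stieltjes_primitive T A h B" "0 \<le> s" "s \<le> t" "t \<le> T" "\<And>u. u \<in> {s..t} \<Longrightarrow> \<bar>h u - c\<bar> \<le> e"
  shows "\<bar>B t - B s - c * (A t - A s)\<bar> \<le> e * (A t - A s)"
  using assms(1)[unfolded stieltjes_primitive_def, THEN conjunct2, rule_format, of s t c e] assms(2-5) by blast

text \<open>The case \<open>c = 0\<close>: \<open>B\<close> is Lipschitz relative to the clock
  \<open>A\<close>, the source of both its continuity and its finite variation.\<close>

lemma stieltjes_primitive_lipschitz:
  assumes "stieltjes_primitive T A h B" "0 \<le> s" "s \<le> t" "t \<le> T" "\<And>u. u \<in> {0..T} \<Longrightarrow> \<bar>h u\<bar> \<le> M"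
  shows "\<bar>B t - B s\<bar> \<le> M * (A t - A s)"
  using stieltjes_primitiveD[of T A h B s t 0 M] assms by simp

text \<open>For \<open>0 \<le> h \<le> M\<close> the mean value estimate is used with centre and
  radius both \<open>M / 2\<close>; the lower bound it gives for \<open>B t - B s\<close> is then
  exactly \<open>0\<close>.\<close>

lemma stieltjes_primitive_mono:
  assumes "stieltjes_primitive T A h B" "mono_on {0..T} A" "continuous_on {0..T} h"
    and "\<And>u. u \<in> {0..T} \<Longrightarrow> 0 \<le> h u"
  shows "mono_on {0..T} B"
proof (rule mono_onI)
  fix s t assume st: "s \<in> {0..T}" "t \<in> {0..T}" "s \<le> t"
  have "bounded (h ` {0..T})"
    using assms(3) by (intro compact_imp_bounded compact_continuous_image) auto
  then obtain M where "\<forall>y\<in>h ` {0..T}. norm y \<le> M"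
    unfolding bounded_iff ..
  then have M: "\<bar>h u\<bar> \<le> M" if "u \<in> {0..T}" for u
    using that by simp
  have "\<bar>h u - M / 2\<bar> \<le> M / 2" if "u \<in> {s..t}" for u
  proof -
    have "0 \<le> h u" "h u \<le> M"
      using M[of u] assms(4)[of u] that st by auto
    then show ?thesis by (auto simp: abs_le_iff field_simps)
  qed
  then have "\<bar>B t - B s - M / 2 * (A t - A s)\<bar> \<le> M / 2 * (A t - A s)"
    using st by (intro stieltjes_primitiveD[OF assms(1)]) simp_all
  then show "B s \<le> B t"
    unfolding abs_le_iff by argo
qed

lemma stieltjes_primitive_continuous:
  assumes "stieltjes_primitive T A h B" "continuous_on {0..T} A" "continuous_on {0..T} h"
  shows "continuous_on {0..T} B"
proof -
  have "bounded (h ` {0..T})"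
    using assms(3) by (intro compact_imp_bounded compact_continuous_image) auto
  then obtain M where M: "0 < M" "\<And>u. u \<in> {0..T} \<Longrightarrow> \<bar>h u\<bar> \<le> M"
    unfolding bounded_pos by auto
  have lip: "\<bar>B t - B s\<bar> \<le> M * \<bar>A t - A s\<bar>" if "s \<in> {0..T}" "t \<in> {0..T}" for s t
  proof (cases "s \<le> t")
    case True
    then have "\<bar>B t - B s\<bar> \<le> M * (A t - A s)"
      using stieltjes_primitive_lipschitz[OF assms(1), of s t M] M(2) that by auto
    also have "\<dots> \<le> M * \<bar>A t - A s\<bar>"
      using M(1) by (intro mult_left_mono) auto
    finally show ?thesis .
  next
    case False
    then have "\<bar>B s - B t\<bar> \<le> M * (A s - A t)"
      using stieltjes_primitive_lipschitz[OF assms(1), of t s M] M(2) that by auto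
    also have "\<dots> \<le> M * \<bar>A t - A s\<bar>"
      using M(1) by (intro mult_left_mono) auto
    finally show ?thesis by (simp add: abs_minus_commute)
  qed
  show ?thesis
    unfolding continuous_on_iff
  proof (intro ballI allI impI)
    fix s e :: real assume s: "s \<in> {0..T}" and e: "0 < e"
    obtain d where d: "0 < d" "\<And>t. t \<in> {0..T} \<Longrightarrow> dist t s < d \<Longrightarrow> dist (A t) (A s) < e / M"
      using assms(2)[unfolded continuous_on_iff, rule_format, OF s, of "e / M"] e M(1) by auto
    have "dist (B t) (B s) < e" if "t \<in> {0..T}" "dist t s < d" for t
    proof -
      have "M * \<bar>A t - A s\<bar> < e"
        using d(2)[OF that] M(1) by (simp add: dist_real_def field_simps)
      then show ?thesis
        using lip[OF s that(1)] by (simp add: dist_real_def)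
    qed
    then show "\<exists>d>0. \<forall>t\<in>{0..T}. dist t s < d \<longrightarrow> dist (B t) (B s) < e"
      using d(1) by blast
  qed
qed

text \<open>The error splits into four parts: replacing \<open>h\<close> by the Lipschitz
  \<open>k\<close> in the energy sum and in the clock sum, exchanging energy for clock under the
  weight \<open>k\<close>, and comparing the Riemann-Stieltjes sum for \<open>h\<close> with
  \<open>B\<close>.\<close>

lemma weighted_energy_sums_converge:
  assumes T: "0 < T" and x: "has_limiting_energy p T x A" and h: "continuous_on {0..T} h"
    and B: "stieltjes_primitive T A h B"
  shows "uniform_limit {0..T}
    (\<lambda>lam t. \<Sum>i<card lam - 1. h (partition_point lam i) * \<bar>stopped_increment lam x t i\<bar> powr p) B (fine_grids T)"
proof (rule uniform_limitI)
  fix e :: real assume e: "0 < e"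
  have A: "mono_on {0..T} A" "A 0 = 0"
    and V: "uniform_limit {0..T} (\<lambda>lam. stopped_energy p lam x) A (fine_grids T)"
    using x by (auto simp: has_limiting_energy_def energy_converges_iff)
  have A_le: "A s \<le> A t" if "0 \<le> s" "s \<le> t" "t \<le> T" for s t
    using A(1) that by (auto simp: mono_on_def)
  have A_pos: "0 \<le> A T"
    using A_le[of 0 T] A(2) T by simp
  \<comment> \<open>The three errors proportional to \<open>\<eta>\<close> carry total weight
    \<open>3 * A T + 1\<close>, so together they stay below \<open>e / 2\<close>.\<close>
  define \<eta> where "\<eta> = e / (2 * (3 * A T + 2))"
  have \<eta>: "0 < \<eta>" "\<eta> * (3 * A T + 2) = e / 2"
    using e A_pos by (auto simp: \<eta>_def field_simps add_nonneg_eq_0_iff)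
  obtain L k where k: "0 \<le> L" "\<forall>s\<in>{0..T}. \<bar>h s - k s\<bar> < \<eta>"
      "\<forall>s\<in>{0..T}. \<forall>t\<in>{0..T}. \<bar>k s - k t\<bar> \<le> L * \<bar>s - t\<bar>"
    using lipschitz_approximation[OF h \<eta>(1)] .
  \<comment> \<open>Bounds the terminal value plus the variation of \<open>k\<close> on every grid;
    the summand \<open>1\<close> makes it positive for the division below.\<close>
  define K where "K = \<bar>k T\<bar> + L * T + 1"
  have K: "0 < K"
    using k(1) T by (simp add: K_def add_nonneg_pos)
  obtain d where d: "0 < d" "\<forall>s\<in>{0..T}. \<forall>t\<in>{0..T}. \<bar>t - s\<bar> < d \<longrightarrow> \<bar>h t - h s\<bar> < \<eta>"
    using continuous_on_compact_modulus[OF h compact_Icc \<eta>(1)] .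
  \<comment> \<open>Distance below \<open>1\<close> bounds the total energy by
    \<open>A T + 1\<close>; distance below \<open>e / (4 * K)\<close> makes the summation by parts
    term at most \<open>e / 4\<close>.\<close>
  have "\<forall>\<^sub>F lam in fine_grids T. \<forall>t\<in>{0..T}. dist (stopped_energy p lam x t) (A t) < min 1 (e / (4 * K))"
    using V by (rule uniform_limitD) (use e K in simp)
  then show "\<forall>\<^sub>F lam in fine_grids T. \<forall>t\<in>{0..T}.
      dist (\<Sum>i<card lam - 1. h (partition_point lam i) * \<bar>stopped_increment lam x t i\<bar> powr p) (B t) < e"
    using eventually_partition_fine_grids[OF T] eventually_gap_fine_grids[OF T d(1)]
  proof eventually_elim
    case (elim lam)
    interpret time_partition T lam by fact
    let ?v = "partition_point lam" and ?n = "card lam - 1"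
    show ?case
    proof
      fix t assume t: "t \<in> {0..T}"
      let ?w = "\<lambda>i. \<bar>stopped_increment lam x t i\<bar> powr p" and ?a = "stopped_increment lam A t"
      have v: "?v i \<in> {0..T}" if "i \<le> ?n" for i
        using point_in_interval[of i] that card_pos by simp
      have a_nonneg: "0 \<le> ?a i" if "i < ?n" for i
        unfolding stopped_increment_def using stopped_points[OF that t] A_le by auto
      have sum_a: "(\<Sum>i<?n. ?a i) = A t"
        unfolding stopped_increment_def using sum_stopped_differences[OF t, of A] A(2) by simp
      have A_t: "A t \<le> A T"
        using A_le t by simp
      have sum_w: "(\<Sum>i<?n. ?w i) \<le> A T + 1"
      proof -
        have "dist (stopped_energy p lam x t) (A t) < 1"
          using elim(1) t by simp
        then have "stopped_energy p lam x t \<le> A T + 1"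
          using A_t unfolding dist_real_def by linarith
        then show ?thesis by (simp add: stopped_energy_def)
      qed
      have near: "\<bar>\<Sum>i<?n. (h (?v i) - k (?v i)) * c i\<bar> \<le> \<eta> * (\<Sum>i<?n. c i)" if "\<And>i. i < ?n \<Longrightarrow> 0 \<le> c i" for c
      proof -
        have "\<bar>\<Sum>i<?n. (h (?v i) - k (?v i)) * c i\<bar> \<le> (\<Sum>i<?n. \<bar>(h (?v i) - k (?v i)) * c i\<bar>)"
          by (rule sum_abs)
        also have "\<dots> \<le> (\<Sum>i<?n. \<eta> * c i)"
        proof (rule sum_mono)
          fix i assume "i \<in> {..<?n}"
          then have "\<bar>h (?v i) - k (?v i)\<bar> \<le> \<eta>" "0 \<le> c i"
            using k(2) v[of i] that[of i] by (simp_all add: less_imp_le)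
          then show "\<bar>(h (?v i) - k (?v i)) * c i\<bar> \<le> \<eta> * c i"
            by (simp add: abs_mult mult_right_mono)
        qed
        finally show ?thesis by (simp add: sum_distrib_left)
      qed
      have 1: "\<bar>\<Sum>i<?n. (h (?v i) - k (?v i)) * ?w i\<bar> \<le> \<eta> * (A T + 1)"
        by (rule order_trans[OF near mult_left_mono[OF sum_w]]) (use \<eta>(1) in simp_all)
      have 2: "\<bar>\<Sum>i<?n. (h (?v i) - k (?v i)) * ?a i\<bar> \<le> \<eta> * A T"
        by (rule order_trans[OF near[OF a_nonneg]]) (use sum_a A_t \<eta>(1) in simp_all)
      have 3: "\<bar>\<Sum>i<?n. k (?v i) * (?w i - ?a i)\<bar> \<le> e / 4"
      proof -
        have "\<bar>\<Sum>i<?n. k (?v i) * (?w i - ?a i)\<bar>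
            \<le> (\<bar>k (?v ?n)\<bar> + (\<Sum>i<?n. \<bar>k (?v (Suc i)) - k (?v i)\<bar>)) * (e / (4 * K))"
        proof (rule summation_by_parts_bound)
          fix m assume m: "m \<le> ?n"
          have "min (?v m) t \<in> {0..T}"
            using v[OF m] t by auto
          then have "dist (stopped_energy p lam x (min (?v m) t)) (A (min (?v m) t)) < e / (4 * K)"
            using elim(1) by simp
          moreover have "(\<Sum>i<m. ?w i - ?a i) = stopped_energy p lam x (min (?v m) t) - A (min (?v m) t)"
            using t A(2) by (simp add: sum_subtractf partial_energy[OF m] partial_clock[OF m])
          ultimately show "\<bar>\<Sum>i<m. ?w i - ?a i\<bar> \<le> e / (4 * K)"
            by (simp add: dist_real_def)
        qed
        also have "\<dots> \<le> K * (e / (4 * K))"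
        proof (rule mult_right_mono)
          have "(\<Sum>i<?n. \<bar>k (?v (Suc i)) - k (?v i)\<bar>) \<le> (\<Sum>i<?n. L * (?v (Suc i) - ?v i))"
          proof (rule sum_mono)
            fix i assume i: "i \<in> {..<?n}"
            then have "?v i \<le> ?v (Suc i)" by (intro point_mono) auto
            then show "\<bar>k (?v (Suc i)) - k (?v i)\<bar> \<le> L * (?v (Suc i) - ?v i)"
              using k(3)[rule_format, OF v v, of "Suc i" i] i by simp
          qed
          also have "\<dots> = L * T"
            using sum_gaps by (simp add: sum_distrib_left[symmetric])
          finally show "\<bar>k (?v ?n)\<bar> + (\<Sum>i<?n. \<bar>k (?v (Suc i)) - k (?v i)\<bar>) \<le> K"
            unfolding K_def point_last by simp
        qed (use e K in simp)
        finally show ?thesis using K by simp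
      qed
      have 4: "\<bar>(\<Sum>i<?n. h (?v i) * ?a i) - B t\<bar> \<le> \<eta> * A T"
      proof -
        have "B t = (\<Sum>i<?n. B (min (?v (Suc i)) t) - B (min (?v i) t))"
          using sum_stopped_differences[OF t, of B] B by (simp add: stieltjes_primitive_def)
        then have "\<bar>(\<Sum>i<?n. h (?v i) * ?a i) - B t\<bar>
            = \<bar>\<Sum>i<?n. h (?v i) * ?a i - (B (min (?v (Suc i)) t) - B (min (?v i) t))\<bar>"
          by (simp only: sum_subtractf)
        also have "\<dots> \<le> (\<Sum>i<?n. \<bar>h (?v i) * ?a i - (B (min (?v (Suc i)) t) - B (min (?v i) t))\<bar>)"
          by (rule sum_abs)
        also have "\<dots> \<le> (\<Sum>i<?n. \<eta> * ?a i)"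
        proof (rule sum_mono)
          fix i assume i: "i \<in> {..<?n}"
          show "\<bar>h (?v i) * ?a i - (B (min (?v (Suc i)) t) - B (min (?v i) t))\<bar> \<le> \<eta> * ?a i"
          \<comment> \<open>The weight is sampled at \<open>?v i\<close>, not at the stopped point.
            For \<open>?v i > t\<close> the two need not be close, but both stopped endpoints equal
            \<open>t\<close> and all increments vanish.\<close>
          proof (cases "?v i \<le> t")
            case True
            have sp: "min (?v i) t \<in> {0..T}" "min (?v (Suc i)) t \<in> {0..T}"
              "min (?v i) t \<le> min (?v (Suc i)) t"
              using stopped_points[of i t] i t by auto
            have "\<bar>h u - h (?v i)\<bar> \<le> \<eta>" if "u \<in> {min (?v i) t..min (?v (Suc i)) t}" for u
            proof -
              have "?v i \<in> {0..T}" using v i by simp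
              moreover have "u \<in> {0..T}" using sp that by auto
              moreover have "?v (Suc i) - ?v i < d" using elim(3) i by simp
              then have "\<bar>u - ?v i\<bar> < d" using that True by (auto simp: min_def split: if_splits)
              ultimately show ?thesis using d(2) less_imp_le by blast
            qed
            then have "\<bar>B (min (?v (Suc i)) t) - B (min (?v i) t) - h (?v i) * ?a i\<bar> \<le> \<eta> * ?a i"
              unfolding stopped_increment_def using sp by (intro stieltjes_primitiveD[OF B]) simp_all
            then show ?thesis by (simp add: abs_minus_commute)
          next
            case False
            moreover have "?v i \<le> ?v (Suc i)" using i by (intro point_mono) auto
            ultimately show ?thesis by (simp add: stopped_increment_def min_def)
          qed
        qed
        also have "\<dots> \<le> \<eta> * A T"
          using sum_a A_t \<eta>(1) by (simp add: sum_distrib_left[symmetric])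
        finally show ?thesis .
      qed
      have "(\<Sum>i<?n. h (?v i) * ?w i) - B t
          = (\<Sum>i<?n. (h (?v i) - k (?v i)) * ?w i) - (\<Sum>i<?n. (h (?v i) - k (?v i)) * ?a i)
            + (\<Sum>i<?n. k (?v i) * (?w i - ?a i)) + ((\<Sum>i<?n. h (?v i) * ?a i) - B t)"
        by (simp add: algebra_simps sum.distrib sum_subtractf)
      then have "\<bar>(\<Sum>i<?n. h (?v i) * ?w i) - B t\<bar> \<le> \<eta> * (A T + 1) + \<eta> * A T + e / 4 + \<eta> * A T"
        using 1 2 3 4 by linarith
      also have "\<dots> < e"
        using \<eta> e by (simp add: algebra_simps)
      finally show "dist (\<Sum>i<?n. h (?v i) * ?w i) (B t) < e"
        by (simp add: dist_real_def)
    qed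
  qed
qed

section \<open>Perturbations\<close>

text \<open>The coefficient of the main term must be arbitrarily close to \<open>1\<close>,
  otherwise the limit is lost. If \<open>b\<close> is small relative to \<open>a\<close>, it is
  absorbed into \<open>(1 + c) * \<bar>a\<bar>\<close>; otherwise \<open>a\<close> is dominated by a
  multiple of \<open>b\<close>.\<close>

lemma abs_add_powr_le:
  fixes p e :: real
  assumes "0 < p" "0 < e"
  obtains C where "0 \<le> C" "\<forall>a b :: real. \<bar>a + b\<bar> powr p \<le> (1 + e) * \<bar>a\<bar> powr p + C * \<bar>b\<bar> powr p"
proof -
  \<comment> \<open>The threshold for the ratio of \<open>b\<close> to \<open>a\<close>, chosen so
    that \<open>(1 + c) powr p = 1 + e\<close>.\<close>
  define c where "c = (1 + e) powr (1 / p) - 1"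
  have "1 powr (1 / p) < (1 + e) powr (1 / p)"
    using assms by (intro powr_less_mono2) auto
  then have c: "0 < c"
    by (simp add: c_def)
  have c_powr: "(1 + c) powr p = 1 + e"
    using assms by (simp add: c_def powr_powr)
  have "\<bar>a + b\<bar> powr p \<le> (1 + e) * \<bar>a\<bar> powr p + (1 + 1 / c) powr p * \<bar>b\<bar> powr p" for a b :: real
  proof (cases "\<bar>b\<bar> \<le> c * \<bar>a\<bar>")
    case True
    then have "\<bar>a + b\<bar> \<le> (1 + c) * \<bar>a\<bar>"
      by (simp add: algebra_simps abs_triangle_ineq order_trans[OF abs_triangle_ineq])
    then have "\<bar>a + b\<bar> powr p \<le> ((1 + c) * \<bar>a\<bar>) powr p"
      using assms(1) by (intro powr_mono2) auto
    also have "\<dots> = (1 + e) * \<bar>a\<bar> powr p"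
      using c by (simp add: powr_mult c_powr)
    finally show ?thesis
      by (simp add: add_increasing2)
  next
    case False
    then have "\<bar>a\<bar> \<le> 1 / c * \<bar>b\<bar>"
      using c by (simp add: field_simps)
    then have "\<bar>a + b\<bar> \<le> (1 + 1 / c) * \<bar>b\<bar>"
      using abs_triangle_ineq[of a b] by (simp add: distrib_right)
    then have "\<bar>a + b\<bar> powr p \<le> ((1 + 1 / c) * \<bar>b\<bar>) powr p"
      using assms(1) by (intro powr_mono2) auto
    also have "\<dots> = (1 + 1 / c) powr p * \<bar>b\<bar> powr p"
      using c by (simp add: powr_mult)
    finally show ?thesis
      using assms(2) by (simp add: add_increasing)
  qed
  then show ?thesis
    using that[of "(1 + 1 / c) powr p"] by simp
qed

text \<open>
  Comparison of the energies of \<open>s\<close> and \<open>s + r\<close> in both directions by \<open>abs_add_powr_le\<close>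
  replaces Minkowski's inequality.
\<close>

lemma uniform_limit_perturbed_energy:
  fixes r s :: "'a \<Rightarrow> 'b \<Rightarrow> nat \<Rightarrow> real"
  assumes p: "0 < p"
    and s: "uniform_limit X (\<lambda>l t. \<Sum>i<n l. \<bar>s l t i\<bar> powr p) B F"
    and r: "uniform_limit X (\<lambda>l t. \<Sum>i<n l. \<bar>r l t i\<bar> powr p) (\<lambda>t. 0) F"
    and bound: "\<And>t. t \<in> X \<Longrightarrow> B t \<le> M"
  shows "uniform_limit X (\<lambda>l t. \<Sum>i<n l. \<bar>s l t i + r l t i\<bar> powr p) B F"
proof (rule uniform_limitI)
  fix e :: real assume e: "0 < e"
  \<comment> \<open>An a priori bound for the perturbed energy:
    \<open>?V \<le> ?S + \<eta> * ?S + C * ?R\<close> with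
    \<open>?S \<le> \<bar>M\<bar> + 1\<close>, \<open>\<eta> \<le> 1\<close> and
    \<open>C * ?R \<le> 1\<close>. It is needed because the reverse comparison has the error
    \<open>\<eta> * ?V\<close>.\<close>
  define M' where "M' = 2 * (\<bar>M\<bar> + 1) + 1"
  define \<eta> where "\<eta> = min 1 (e / (4 * M'))"
  have M': "0 < M'"
    by (simp add: M'_def add_nonneg_pos)
  have \<eta>: "0 < \<eta>" "\<eta> \<le> 1" "\<eta> * M' \<le> e / 4"
    using e M' mult_right_mono[of \<eta> "e / (4 * M')" M'] by (auto simp: \<eta>_def)
  obtain C where C: "0 \<le> C"
    "\<forall>a b :: real. \<bar>a + b\<bar> powr p \<le> (1 + \<eta>) * \<bar>a\<bar> powr p + C * \<bar>b\<bar> powr p"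
    using abs_add_powr_le[OF p \<eta>(1)] .
  \<comment> \<open>\<open>C\<close> may be \<open>0\<close>, hence the denominator
    \<open>C + 1\<close>. The bound \<open>1\<close> feeds the a priori estimate and
    \<open>e / 8\<close> the final comparison.\<close>
  define \<rho> where "\<rho> = min 1 (e / 8) / (C + 1)"
  have \<rho>: "0 < \<rho>" "C * \<rho> \<le> 1" "C * \<rho> \<le> e / 8"
  proof -
    show "0 < \<rho>" using C(1) e by (simp add: \<rho>_def)
    then have "C * \<rho> \<le> (C + 1) * \<rho>" by simp
    also have "\<dots> = min 1 (e / 8)" using C(1) by (simp add: \<rho>_def)
    finally show "C * \<rho> \<le> 1" "C * \<rho> \<le> e / 8" by simp_all
  qed
  have "\<forall>\<^sub>F l in F. \<forall>t\<in>X. dist (\<Sum>i<n l. \<bar>s l t i\<bar> powr p) (B t) < min 1 (e / 2)"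
    using s by (rule uniform_limitD) (use e in simp)
  moreover have "\<forall>\<^sub>F l in F. \<forall>t\<in>X. dist (\<Sum>i<n l. \<bar>r l t i\<bar> powr p) 0 < \<rho>"
    using r by (rule uniform_limitD) (use \<rho> in simp)
  ultimately show "\<forall>\<^sub>F l in F. \<forall>t\<in>X. dist (\<Sum>i<n l. \<bar>s l t i + r l t i\<bar> powr p) (B t) < e"
  proof eventually_elim
    case (elim l)
    show ?case
    proof
      fix t assume t: "t \<in> X"
      let ?S = "\<Sum>i<n l. \<bar>s l t i\<bar> powr p" and ?R = "\<Sum>i<n l. \<bar>r l t i\<bar> powr p"
        and ?V = "\<Sum>i<n l. \<bar>s l t i + r l t i\<bar> powr p"
      have S: "\<bar>?S - B t\<bar> < 1" "\<bar>?S - B t\<bar> < e / 2" "?R < \<rho>"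
        using elim t by (auto simp: dist_real_def)
      have VS: "?V \<le> (1 + \<eta>) * ?S + C * ?R"
        unfolding sum_distrib_left sum.distrib[symmetric] using C(2) by (intro sum_mono) simp
      have SV: "?S \<le> (1 + \<eta>) * ?V + C * ?R"
        unfolding sum_distrib_left sum.distrib[symmetric]
      proof (rule sum_mono)
        fix i
        \<comment> \<open>The reverse comparison treats \<open>s\<close> as a perturbation of
          \<open>s + r\<close> by \<open>- r\<close>.\<close>
        have "\<bar>(s l t i + r l t i) + - r l t i\<bar> powr p
            \<le> (1 + \<eta>) * \<bar>s l t i + r l t i\<bar> powr p + C * \<bar>- r l t i\<bar> powr p"
          using C(2) by blast
        then show "\<bar>s l t i\<bar> powr p \<le> (1 + \<eta>) * \<bar>s l t i + r l t i\<bar> powr p + C * \<bar>r l t i\<bar> powr p"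
          by simp
      qed
      have CR: "C * ?R \<le> 1" "C * ?R \<le> e / 8"
        using mult_left_mono[of ?R \<rho> C] S(3) C(1) \<rho> by linarith+
      have nonneg: "0 \<le> ?S" "0 \<le> ?V"
        by (simp_all add: sum_nonneg)
      have S_le: "?S \<le> \<bar>M\<bar> + 1"
        using S(1) bound[OF t] by linarith
      have "\<eta> * ?S \<le> ?S"
        using mult_right_mono[OF \<eta>(2) nonneg(1)] by simp
      then have "\<eta> * ?S \<le> \<bar>M\<bar> + 1"
        using S_le by (rule order_trans)
      moreover have "?V \<le> ?S + \<eta> * ?S + C * ?R"
        using VS by (simp add: distrib_right)
      ultimately have "?V \<le> (\<bar>M\<bar> + 1) + (\<bar>M\<bar> + 1) + 1"
        using S_le CR(1) by (meson add_mono order_trans)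
      then have V_le: "?V \<le> M'"
        by (simp add: M'_def)
      have "?S \<le> M'"
        using S_le abs_ge_zero[of M] unfolding M'_def by argo
      then have "\<eta> * ?S \<le> e / 4" "\<eta> * ?V \<le> e / 4"
        using V_le mult_left_mono[of ?S M' \<eta>] mult_left_mono[of ?V M' \<eta>] \<eta> by linarith+
      moreover have "\<bar>v - u\<bar> < e / 2"
        if "v \<le> u + a + c" "u \<le> v + b + c" "a \<le> e / 4" "b \<le> e / 4" "c \<le> e / 8" for u v a b c
        using that e by linarith
      ultimately have "\<bar>?V - ?S\<bar> < e / 2"
        using VS SV CR(2) by (simp add: distrib_right)
      then show "dist ?V (B t) < e"
        using S(2) unfolding dist_real_def by linarith
    qed
  qed
qed

lemma stopped_increment_add:
  "stopped_increment lam (\<lambda>t. y t + z t) t i = stopped_increment lam y t i + stopped_increment lam z t i"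
  by (simp add: stopped_increment_def)

text \<open>The increments of \<open>z\<close> simply join the remainder. The perturbation lemma
  applies with the remainder of \<open>y\<close> as the main term and limit
  \<open>0\<close>.\<close>

lemma remainder_vanishes_add:
  assumes "0 < p" "remainder_vanishes p T y x g" "energy_converges p T z (\<lambda>t. 0)"
  shows "remainder_vanishes p T (\<lambda>t. y t + z t) x g"
proof -
  have "uniform_limit {0..T} (\<lambda>lam t. \<Sum>i<card lam - 1.
      \<bar>(stopped_increment lam y t i - g (partition_point lam i) * stopped_increment lam x t i)
        + stopped_increment lam z t i\<bar> powr p) (\<lambda>t. 0) (fine_grids T)"
    using assms unfolding remainder_vanishes_iff energy_converges_iff stopped_energy_def
    by (intro uniform_limit_perturbed_energy[where M=0]) auto
  then show ?thesis
    unfolding remainder_vanishes_iff stopped_increment_add by (simp add: algebra_simps)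
qed

lemma energy_converges_of_remainder:
  assumes T: "0 < T" and p: "0 < p" and x: "has_limiting_energy p T x A"
    and g: "continuous_on {0..T} g" and y: "remainder_vanishes p T y x g"
    and B: "stieltjes_primitive T A (\<lambda>s. \<bar>g s\<bar> powr p) B"
  shows "energy_converges p T y B"
proof -
  have h: "continuous_on {0..T} (\<lambda>s. \<bar>g s\<bar> powr p)"
    using g p by (intro continuous_on_powr' continuous_intros) auto
  have "continuous_on {0..T} B"
    using stieltjes_primitive_continuous[OF B _ h] x by (simp add: has_limiting_energy_def)
  then have "bounded (B ` {0..T})"
    by (intro compact_imp_bounded compact_continuous_image) auto
  then obtain M where M: "\<forall>b\<in>B ` {0..T}. norm b \<le> M"
    unfolding bounded_iff ..
  have "uniform_limit {0..T} (\<lambda>lam t. \<Sum>i<card lam - 1.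
      \<bar>g (partition_point lam i) * stopped_increment lam x t i\<bar> powr p) B (fine_grids T)"
    using weighted_energy_sums_converge[OF T x h B] by (simp add: abs_mult powr_mult)
  then have "uniform_limit {0..T} (\<lambda>lam t. \<Sum>i<card lam - 1.
      \<bar>g (partition_point lam i) * stopped_increment lam x t i
        + (stopped_increment lam y t i - g (partition_point lam i) * stopped_increment lam x t i)\<bar> powr p)
      B (fine_grids T)"
    using M by (intro uniform_limit_perturbed_energy[OF p _ y[unfolded remainder_vanishes_iff], where M=M])
      (auto simp: abs_le_iff)
  then show ?thesis
    by (simp add: energy_converges_iff stopped_energy_def[abs_def])
qed

text \<open>The error is measured against the increment of \<open>x\<close>, not against elapsed
  time. Its \<open>p\<close>-th powers therefore sum to at most a small constant times the energy of
  \<open>x\<close>, which is eventually bounded.\<close>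

lemma remainder_vanishes_first_order:
  assumes T: "0 < T" and p: "0 < p" and x: "energy_converges p T x A"
    and A: "\<And>t. t \<in> {0..T} \<Longrightarrow> A t \<le> M"
    and y: "\<And>e. 0 < e \<Longrightarrow> \<exists>d>0. \<forall>s\<in>{0..T}. \<forall>t\<in>{0..T}. \<bar>t - s\<bar> < d \<longrightarrow>
      \<bar>y t - y s - g s * (x t - x s)\<bar> \<le> e * \<bar>x t - x s\<bar>"
  shows "remainder_vanishes p T y x g"
  unfolding remainder_vanishes_iff
proof (rule uniform_limitI)
  fix e :: real assume e: "0 < e"
  \<comment> \<open>Chosen so that \<open>c powr p * (\<bar>M\<bar> + 1) = e / 2\<close>.\<close>
  define c where "c = (e / (2 * (\<bar>M\<bar> + 1))) powr (1 / p)"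
  have c: "0 < c" "c powr p * (\<bar>M\<bar> + 1) < e"
    using e p by (auto simp: c_def powr_powr add_nonneg_eq_0_iff field_simps add_pos_nonneg)
  obtain d where d: "0 < d" "\<forall>s\<in>{0..T}. \<forall>t\<in>{0..T}. \<bar>t - s\<bar> < d \<longrightarrow>
      \<bar>y t - y s - g s * (x t - x s)\<bar> \<le> c * \<bar>x t - x s\<bar>"
    using y[OF c(1)] by (elim exE conjE)
  have "\<forall>\<^sub>F lam in fine_grids T. \<forall>t\<in>{0..T}. stopped_energy p lam x t \<le> M + 1"
    using uniform_limit_bounded_eventually[OF x[unfolded energy_converges_iff] A] .
  then show "\<forall>\<^sub>F lam in fine_grids T. \<forall>t\<in>{0..T}. dist (\<Sum>i<card lam - 1.
      \<bar>stopped_increment lam y t i - g (partition_point lam i) * stopped_increment lam x t i\<bar> powr p) 0 < e"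
    using eventually_partition_fine_grids[OF T] eventually_gap_fine_grids[OF T d(1)]
  proof eventually_elim
    case (elim lam)
    interpret time_partition T lam by fact
    let ?v = "partition_point lam" and ?n = "card lam - 1"
    show ?case
    proof
      fix t assume t: "t \<in> {0..T}"
      let ?r = "\<lambda>i. \<bar>stopped_increment lam y t i - g (?v i) * stopped_increment lam x t i\<bar>"
      have "(\<Sum>i<?n. ?r i powr p) \<le> (\<Sum>i<?n. c powr p * \<bar>stopped_increment lam x t i\<bar> powr p)"
      proof (rule sum_mono)
        fix i assume "i \<in> {..<?n}"
        then have i: "i < ?n" by simp
        have "?r i \<le> c * \<bar>stopped_increment lam x t i\<bar>"
        proof (cases "?v i \<le> t")
          case True
          have "?v i \<in> {0..T}" "min (?v (Suc i)) t \<in> {0..T}" "\<bar>min (?v (Suc i)) t - ?v i\<bar> < d"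
            using stopped_points[OF i t] elim(3) i True by (auto simp: min_absorb1)
          then show ?thesis
            using d(2) True by (simp add: stopped_increment_def min_absorb1)
        next
          case False
          moreover have "?v i \<le> ?v (Suc i)" using i by (intro point_mono) auto
          ultimately show ?thesis by (simp add: stopped_increment_def min_absorb2)
        qed
        then have "?r i powr p \<le> (c * \<bar>stopped_increment lam x t i\<bar>) powr p"
          using p by (intro powr_mono2) auto
        also have "\<dots> = c powr p * \<bar>stopped_increment lam x t i\<bar> powr p"
          using c(1) by (simp add: powr_mult)
        finally show "?r i powr p \<le> c powr p * \<bar>stopped_increment lam x t i\<bar> powr p" .
      qed
      also have "\<dots> = c powr p * stopped_energy p lam x t"
        by (simp add: stopped_energy_def sum_distrib_left)
      also have "\<dots> \<le> c powr p * (\<bar>M\<bar> + 1)"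
      proof (rule mult_left_mono)
        show "stopped_energy p lam x t \<le> \<bar>M\<bar> + 1"
          using bspec[OF elim(1) t] by linarith
      qed simp
      also have "\<dots> < e" by fact
      finally show "dist (\<Sum>i<?n. ?r i powr p) 0 < e"
        by (simp add: dist_real_def sum_nonneg)
    qed
  qed
qed

section \<open>Paths of vanishing energy\<close>

text \<open>Stopping cuts at most one cell, the one containing \<open>t\<close> in its interior;
  cells before it are unchanged and later ones contribute \<open>0\<close>. This links stopped
  energies to the full partition sums in \<open>finite_variation\<close>.\<close>

lemma (in time_partition) sum_stopped_powr_le:
  assumes p: "0 < p" and t: "t \<in> {0..T}"
    and W: "\<And>i. i < card lam - 1 \<Longrightarrow> \<bar>stopped_increment lam z t i\<bar> \<le> W"
  shows "stopped_energy p lam z t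
    \<le> (\<Sum>i<card lam - 1. \<bar>z (partition_point lam (Suc i)) - z (partition_point lam i)\<bar> powr p) + W powr p"
proof -
  let ?v = "partition_point lam"
  let ?s = "\<lambda>i. \<bar>stopped_increment lam z t i\<bar> powr p" and ?f = "\<lambda>i. \<bar>z (?v (Suc i)) - z (?v i)\<bar> powr p"
  \<comment> \<open>The allowance \<open>W powr p\<close> may be spent only once, so the induction
    keeps exact equality as long as \<open>t\<close> has not been passed.\<close>
  have "(?v m \<le> t \<longrightarrow> (\<Sum>i<m. ?s i) = (\<Sum>i<m. ?f i)) \<and> (\<Sum>i<m. ?s i) \<le> (\<Sum>i<m. ?f i) + W powr p"
    if "m \<le> card lam - 1" for m
    using that
  proof (induction m)
    case (Suc m)
    then have IH: "?v m \<le> t \<Longrightarrow> (\<Sum>i<m. ?s i) = (\<Sum>i<m. ?f i)" "(\<Sum>i<m. ?s i) \<le> (\<Sum>i<m. ?f i) + W powr p"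
      by auto
    have mono: "?v m \<le> ?v (Suc m)"
      using Suc.prems by (intro point_mono) auto
    consider "?v (Suc m) \<le> t" | "?v m \<le> t" "t < ?v (Suc m)" | "t < ?v m"
      by linarith
    then show ?case
    proof cases
      case 1
      then have "?s m = ?f m"
        using mono by (simp add: stopped_increment_def min_absorb1)
      then show ?thesis
        using IH 1 mono by simp
    next
      case 2
      have "?s m \<le> W powr p"
        using W[of m] Suc.prems p by (intro powr_mono2) auto
      moreover have "0 \<le> ?f m" by simp
      ultimately show ?thesis
        using 2(2) IH(1)[OF 2(1)] by (simp add: add_increasing)
    next
      case 3
      then have "?s m = 0"
        using mono by (simp add: stopped_increment_def min_absorb2)
      moreover have "0 \<le> ?f m" by simp
      ultimately show ?thesis
        using IH(2) 3 mono unfolding sum.lessThan_Suc by linarith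
    qed
  qed simp
  then show ?thesis
    unfolding stopped_energy_def by blast
qed

text \<open>One factor of each \<open>p\<close>-th power goes to the variation, and the remaining
  power \<open>p - 1 > 0\<close> is uniformly small by uniform continuity.\<close>

lemma finite_variation_energy:
  assumes T: "0 < T" and p: "1 < p" and z: "continuous_on {0..T} z" "finite_variation T z"
  shows "energy_converges p T z (\<lambda>t. 0)"
  unfolding energy_converges_iff
proof (rule uniform_limitI)
  fix e :: real assume e: "0 < e"
  obtain C where C: "\<forall>lam. finite lam \<and> {0, T} \<subseteq> lam \<and> lam \<subseteq> {0..T} \<longrightarrow>
      (\<Sum>i<card lam - 1. \<bar>z (partition_point lam (Suc i)) - z (partition_point lam i)\<bar>) \<le> C"
    using z(2) unfolding finite_variation_def ..
  define c where "c = e / (2 * (\<bar>C\<bar> + 1))"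
  \<comment> \<open>\<open>W powr (p - 1) \<le> c\<close> controls the full sum, and
    \<open>W \<le> 1\<close> gives \<open>W powr p \<le> c\<close> for the cut cell; the total is at
    most \<open>c * (\<bar>C\<bar> + 1) = e / 2\<close>.\<close>
  define W where "W = min 1 (c powr (1 / (p - 1)))"
  have c: "0 < c" "c * (\<bar>C\<bar> + 1) < e"
    using e by (auto simp: c_def field_simps add_nonneg_eq_0_iff add_pos_nonneg)
  have W: "0 < W" "W \<le> 1"
    using c by (auto simp: W_def)
  have "W powr (p - 1) \<le> (c powr (1 / (p - 1))) powr (p - 1)"
    using W(1) p by (intro powr_mono2) (auto simp: W_def)
  also have "\<dots> = c"
    using c p by (simp add: powr_powr)
  finally have W_c: "W powr (p - 1) \<le> c" .
  have W_p: "W powr p \<le> W powr (p - 1)"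
    using W by (intro powr_mono') auto
  obtain d where d: "0 < d" "\<forall>s\<in>{0..T}. \<forall>t\<in>{0..T}. \<bar>t - s\<bar> < d \<longrightarrow> \<bar>z t - z s\<bar> < W"
    using continuous_on_compact_modulus[OF z(1) compact_Icc W(1)] .
  show "\<forall>\<^sub>F lam in fine_grids T. \<forall>t\<in>{0..T}. dist (stopped_energy p lam z t) 0 < e"
    using eventually_partition_fine_grids[OF T] eventually_gap_fine_grids[OF T d(1)]
  proof eventually_elim
    case (elim lam)
    interpret time_partition T lam by fact
    let ?v = "partition_point lam" and ?n = "card lam - 1"
    have small: "\<bar>stopped_increment lam z t i\<bar> \<le> W" if "i < ?n" "t \<in> {0..T}" for i t
    proof -
      have "\<bar>min (?v (Suc i)) t - min (?v i) t\<bar> < d"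
        using stopped_points[OF that] elim(2) that(1) by force
      then show ?thesis
        using d(2)[rule_format, OF stopped_points(1,2)[OF that]] unfolding stopped_increment_def by simp
    qed
    show ?case
    proof
      fix t assume t: "t \<in> {0..T}"
      have "(\<Sum>i<?n. \<bar>z (?v (Suc i)) - z (?v i)\<bar> powr p) \<le> (\<Sum>i<?n. W powr (p - 1) * \<bar>z (?v (Suc i)) - z (?v i)\<bar>)"
      proof (rule sum_mono)
        fix i assume i: "i \<in> {..<?n}"
        let ?z = "\<bar>z (?v (Suc i)) - z (?v i)\<bar>"
        have "?v i \<le> T" "?v (Suc i) \<le> T"
          using point_in_interval[of i] point_in_interval[of "Suc i"] i by auto
        then have "?z \<le> W"
          using small[of i T] i T by (simp add: stopped_increment_def min_absorb1)
        then have "?z powr (p - 1) \<le> W powr (p - 1)"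
          using p by (intro powr_mono2) auto
        then have "?z powr (p - 1) * ?z \<le> W powr (p - 1) * ?z"
          by (rule mult_right_mono) simp
        moreover have "?z powr p = ?z powr (p - 1) * ?z"
          using powr_mult_base[of ?z "p - 1"] by (simp add: mult.commute)
        ultimately show "?z powr p \<le> W powr (p - 1) * ?z" by simp
      qed
      also have "\<dots> = W powr (p - 1) * (\<Sum>i<?n. \<bar>z (?v (Suc i)) - z (?v i)\<bar>)"
        by (simp add: sum_distrib_left)
      also have "\<dots> \<le> W powr (p - 1) * \<bar>C\<bar>"
      proof (rule mult_left_mono)
        have "(\<Sum>i<?n. \<bar>z (?v (Suc i)) - z (?v i)\<bar>) \<le> C"
          using C finite_points endpoints points_subset by blast
        then show "(\<Sum>i<?n. \<bar>z (?v (Suc i)) - z (?v i)\<bar>) \<le> \<bar>C\<bar>" by linarith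
      qed simp
      finally have "stopped_energy p lam z t \<le> W powr (p - 1) * \<bar>C\<bar> + W powr p"
        using sum_stopped_powr_le[of p t z W] small t p by fastforce
      also have "\<dots> \<le> c * (\<bar>C\<bar> + 1)"
        using W_p W_c mult_right_mono[OF W_c, of "\<bar>C\<bar>"] by (simp add: distrib_left)
      also have "\<dots> < e" by fact
      finally show "dist (stopped_energy p lam z t) 0 < e"
        by (simp add: dist_real_def stopped_energy_def sum_nonneg)
    qed
  qed
qed

text \<open>Each term is at most a constant times the gap to the power
  \<open>\<alpha> * p > 1\<close>. One factor of the gap sums to \<open>T\<close>; the rest is small
  because the gaps are.\<close>

lemma holder_energy:
  assumes T: "0 < T" and p: "0 < p" and \<alpha>: "1 / p < \<alpha>" and z: "holder_on \<alpha> {0..T} z"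
  shows "energy_converges p T z (\<lambda>t. 0)"
  unfolding energy_converges_iff
proof (rule uniform_limitI)
  fix e :: real assume e: "0 < e"
  obtain C0 where C0: "\<forall>s\<in>{0..T}. \<forall>t\<in>{0..T}. \<bar>z s - z t\<bar> \<le> C0 * \<bar>s - t\<bar> powr \<alpha>"
    using z unfolding holder_on_def ..
  define C where "C = \<bar>C0\<bar> + 1"
  have C: "0 < C" "\<bar>z s - z t\<bar> \<le> C * \<bar>s - t\<bar> powr \<alpha>" if "s \<in> {0..T}" "t \<in> {0..T}" for s t
  proof -
    show "0 < C" by (simp add: C_def add_nonneg_pos)
    have "\<bar>z s - z t\<bar> \<le> C0 * \<bar>s - t\<bar> powr \<alpha>"
      using C0 that by simp
    also have "\<dots> \<le> C * \<bar>s - t\<bar> powr \<alpha>"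
      by (intro mult_right_mono) (auto simp: C_def)
    finally show "\<bar>z s - z t\<bar> \<le> C * \<bar>s - t\<bar> powr \<alpha>" .
  qed
  have C_pos: "0 < C" using C[of 0 0] T by simp
  have "0 < 1 / p" using p by simp
  then have \<alpha>_pos: "0 < \<alpha>" and \<alpha>p: "0 < \<alpha> * p - 1"
    using \<alpha> p by (linarith, simp add: field_simps)
  define c where "c = e / (2 * (C powr p * T))"
  \<comment> \<open>Gaps up to \<open>d\<close> have power \<open>\<alpha> * p - 1\<close> at most
    \<open>c\<close>, so the energy is at most \<open>C powr p * (c * T) = e / 2\<close>.\<close>
  define d where "d = c powr (1 / (\<alpha> * p - 1))"
  have c: "0 < c" "C powr p * (c * T) < e"
    using e C_pos T by (auto simp: c_def field_simps)
  have d: "0 < d" "d powr (\<alpha> * p - 1) = c"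
    using c \<alpha>p by (auto simp: d_def powr_powr)
  show "\<forall>\<^sub>F lam in fine_grids T. \<forall>t\<in>{0..T}. dist (stopped_energy p lam z t) 0 < e"
    using eventually_partition_fine_grids[OF T] eventually_gap_fine_grids[OF T d(1)]
  proof eventually_elim
    case (elim lam)
    interpret time_partition T lam by fact
    let ?v = "partition_point lam" and ?n = "card lam - 1"
    show ?case
    proof
      fix t assume t: "t \<in> {0..T}"
      have "stopped_energy p lam z t \<le> (\<Sum>i<?n. C powr p * (c * (?v (Suc i) - ?v i)))"
        unfolding stopped_energy_def
      proof (rule sum_mono)
        fix i assume "i \<in> {..<?n}"
        then have i: "i < ?n" by simp
        let ?g = "?v (Suc i) - ?v i"
        have g: "0 < ?g" "?g \<le> d"
          using point_less_iff[of i "Suc i"] i elim(2) by (auto simp: less_imp_le)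
        have "\<bar>stopped_increment lam z t i\<bar> \<le> C * \<bar>min (?v (Suc i)) t - min (?v i) t\<bar> powr \<alpha>"
          unfolding stopped_increment_def using C(2) stopped_points[OF i t] by blast
        also have "\<dots> \<le> C * ?g powr \<alpha>"
          using stopped_points[OF i t] C_pos \<alpha>_pos by (intro mult_left_mono powr_mono2) auto
        finally have "\<bar>stopped_increment lam z t i\<bar> powr p \<le> (C * ?g powr \<alpha>) powr p"
          using p by (intro powr_mono2) auto
        also have "\<dots> = C powr p * (?g powr (\<alpha> * p - 1) * ?g)"
          using C_pos powr_mult_base[of ?g "\<alpha> * p - 1"] g by (simp add: powr_mult powr_powr mult.commute)
        also have "\<dots> \<le> C powr p * (c * ?g)"
          using powr_mono2[of "\<alpha> * p - 1" ?g d] g \<alpha>p d(2) by (intro mult_left_mono mult_right_mono) auto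
        finally show "\<bar>stopped_increment lam z t i\<bar> powr p \<le> C powr p * (c * ?g)" .
      qed
      also have "\<dots> = C powr p * (c * T)"
        by (simp only: sum_distrib_left[symmetric] sum_gaps)
      also have "\<dots> < e" by fact
      finally show "dist (stopped_energy p lam z t) 0 < e"
        by (simp add: dist_real_def stopped_energy_def sum_nonneg)
    qed
  qed
qed

section \<open>The energy measure\<close>

text \<open>Pushing both measures to the whole line by \<open>id\<close> allows comparison on
  half-lines. The mass of \<open>{u<..}\<close> is the total mass minus that of
  \<open>{0..u}\<close>, and finiteness makes the subtraction legitimate.\<close>

lemma measure_eqI_Icc:
  fixes M N :: "real measure"
  assumes sets: "sets M = sets (restrict_space borel {0..T})" "sets N = sets (restrict_space borel {0..T})"
    and fin: "\<And>t. t \<in> {0..T} \<Longrightarrow> emeasure M {0..t} < \<infinity>"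
    and eq: "\<And>t. t \<in> {0..T} \<Longrightarrow> emeasure M {0..t} = emeasure N {0..t}"
  shows "M = N"
proof (cases "0 \<le> T")
  case True
  have distr_emeasure: "emeasure (distr L borel id) X = emeasure L (X \<inter> {0..T})"
    if "sets L = sets (restrict_space borel {0..T})" "X \<in> sets borel" for L and X :: "real set"
  proof -
    have "space L = {0..T}"
      using sets_eq_imp_space_eq[OF that(1)] by (simp add: space_restrict_space)
    moreover have "id \<in> measurable L borel"
      using that(1) by (subst measurable_cong_sets[OF that(1) refl]) (simp add: measurable_restrict_space1)
    ultimately show ?thesis
      using that(2) by (simp add: emeasure_distr)
  qed
  have Ioi: "emeasure (distr L borel id) {u<..} =
      (if u < 0 then emeasure L {0..T} else if T \<le> u then 0 else emeasure L {0..T} - emeasure L {0..u})"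
    if L: "sets L = sets (restrict_space borel {0..T})" "\<forall>t\<in>{0..T}. emeasure L {0..t} < \<infinity>" for L u
  proof -
    have "{0..u} \<in> sets L" if "u \<le> T" for u
      using that unfolding L(1) by (auto simp: sets_restrict_space image_iff intro!: bexI[of _ "{0..u}"])
    moreover have "{u<..} \<inter> {0..T} = (if u < 0 then {0..T} else if T \<le> u then {} else {0..T} - {0..u})"
      by auto
    ultimately show ?thesis
      using L(2) by (simp add: distr_emeasure[OF L(1)] emeasure_Diff less_top)
  qed
  have fin': "\<forall>t\<in>{0..T}. emeasure M {0..t} < \<infinity>" "\<forall>t\<in>{0..T}. emeasure N {0..t} < \<infinity>"
    using fin eq by simp_all
  have distr_eq: "distr M borel id = distr N borel id"
  proof (rule measure_eqI_lessThan)
    fix u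
    show "emeasure (distr M borel id) {u<..} < \<infinity>"
    proof -
      have "{0..T} \<in> sets M"
        unfolding sets(1) by (auto simp: sets_restrict_space image_iff intro!: bexI[of _ "{0..T}"])
      then have "emeasure M ({u<..} \<inter> {0..T}) \<le> emeasure M {0..T}"
        by (intro emeasure_mono) auto
      also have "\<dots> < \<infinity>"
        using fin[of T] True by simp
      finally show ?thesis
        by (simp add: distr_emeasure[OF sets(1)])
    qed
    show "emeasure (distr M borel id) {u<..} = emeasure (distr N borel id) {u<..}"
      using eq True unfolding Ioi[OF sets(1) fin'(1)] Ioi[OF sets(2) fin'(2)] by simp
  qed simp_all
  show ?thesis
  proof (rule measure_eqI)
    fix X assume "X \<in> sets M"
    then have "X \<in> sets borel" "X \<inter> {0..T} = X"
      unfolding sets(1) by (auto simp: sets_restrict_space)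
    then show "emeasure M X = emeasure N X"
      using distr_emeasure[OF sets(1), of X] distr_emeasure[OF sets(2), of X] distr_eq by simp
  qed (simp add: sets)
next
  case False
  then have "sets M = {{}}" "sets N = {{}}"
    unfolding sets by (auto simp: sets_restrict_space)
  then show ?thesis
    by (intro measure_eqI) auto
qed

lemma sets_energy_measure: "sets (energy_measure p T x) = sets (restrict_space borel {0..T})"
  unfolding energy_measure_def by (intro sets_restrict_space_cong) simp

lemma space_energy_measure: "space (energy_measure p T x) = {0..T}"
  using sets_eq_imp_space_eq[OF sets_energy_measure] by (simp add: space_restrict_space)

text \<open>Built on \<open>has_limiting_energy\<close> instead of \<open>rough_paths\<close>, so
  that it also covers a zero limit, as arises for transformed paths.\<close>

locale limiting_energy_path =
  fixes p T :: real and x A :: "real \<Rightarrow> real"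
  assumes horizon: "0 < T" and energy: "has_limiting_energy p T x A"
begin

abbreviation "\<mu> \<equiv> energy_measure p T x"

lemma A_0: "A 0 = 0" and A_mono: "mono_on {0..T} A" and A_continuous: "continuous_on {0..T} A"
  and x_continuous: "continuous_on {0..T} x" and x_converges: "energy_converges p T x A"
  using energy by (auto simp: has_limiting_energy_def)

lemma A_le: "0 \<le> s \<Longrightarrow> s \<le> t \<Longrightarrow> t \<le> T \<Longrightarrow> A s \<le> A t"
  using A_mono by (auto simp: mono_on_def)

lemma A_nonneg: "t \<in> {0..T} \<Longrightarrow> 0 \<le> A t"
  using A_le[of 0 t] A_0 by simp

lemma emeasure_Icc: "t \<in> {0..T} \<Longrightarrow> emeasure \<mu> {0..t} = ennreal (A t)"
  by (rule emeasure_energy_measure[OF horizon energy])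

lemma finite_energy_measure: "finite_measure \<mu>"
  using emeasure_Icc[of T] horizon by (intro finite_measureI) (simp add: space_energy_measure)

lemma Icc_in_sets: "s \<in> {0..T} \<Longrightarrow> t \<in> {0..T} \<Longrightarrow> {s..t} \<in> sets \<mu>"
  unfolding sets_energy_measure by (auto simp: sets_restrict_space image_iff intro!: bexI[of _ "{s..t}"])

lemma Ioc_in_sets: "s \<in> {0..T} \<Longrightarrow> t \<in> {0..T} \<Longrightarrow> {s<..t} \<in> sets \<mu>"
  unfolding sets_energy_measure by (auto simp: sets_restrict_space image_iff intro!: bexI[of _ "{s<..t}"])

lemma measure_Icc: "t \<in> {0..T} \<Longrightarrow> measure \<mu> {0..t} = A t"
  using emeasure_Icc A_nonneg by (simp add: measure_def)

lemma measure_Ioc: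
  assumes "0 \<le> s" "s \<le> t" "t \<le> T"
  shows "measure \<mu> {s<..t} = A t - A s"
proof -
  interpret finite_measure \<mu> by (rule finite_energy_measure)
  have "{s<..t} = {0..t} - {0..s}" using assms by auto
  then show ?thesis
    using assms finite_measure_Diff[of "{0..t}" "{0..s}"] Icc_in_sets measure_Icc by auto
qed

lemma set_integrable_continuous:
  fixes h :: "real \<Rightarrow> real"
  assumes "continuous_on {0..T} h" "S \<in> sets \<mu>"
  shows "set_integrable \<mu> S h"
proof -
  interpret finite_measure \<mu> by (rule finite_energy_measure)
  have "bounded (h ` {0..T})"
    using assms(1) by (intro compact_imp_bounded compact_continuous_image) auto
  then obtain M where "\<forall>y\<in>h ` {0..T}. norm y \<le> M"
    unfolding bounded_iff ..
  moreover have "h \<in> borel_measurable \<mu>"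
    using borel_measurable_continuous_on_restrict[OF assms(1)]
    by (simp cong: measurable_cong_sets add: sets_energy_measure)
  ultimately have "integrable \<mu> h"
    by (intro integrable_const_bound[of _ M]) (auto simp: space_energy_measure)
  then have "set_integrable \<mu> (space \<mu>) h"
    unfolding set_integrable_def by (rule integrable_mult_indicator[OF sets.top])
  then show ?thesis
    using assms(2) by (rule set_integrable_subset) (simp add: sets.sets_into_space assms(2))
qed

text \<open>On \<open>{s<..t}\<close> the integrand lies between \<open>c - e\<close> and
  \<open>c + e\<close>, and this set has mass \<open>A t - A s\<close>.\<close>

lemma stieltjes_primitive_integral:
  assumes h: "continuous_on {0..T} h"
  shows "stieltjes_primitive T A h (\<lambda>t. LINT s:{0..t}|\<mu>. h s)"
  unfolding stieltjes_primitive_def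
proof (intro conjI allI impI, goal_cases)
  case 1
  \<comment> \<open>The integral up to time \<open>0\<close> runs over the closed set
    \<open>{0..0}\<close>; the point carries mass \<open>A 0 = 0\<close>.\<close>
  have "{0} \<in> null_sets \<mu>"
    using emeasure_Icc[of 0] Icc_in_sets[of 0 0] horizon A_0 by (intro null_setsI) auto
  then have "AE s in \<mu>. s \<notin> {0}"
    by (rule AE_not_in)
  then have "AE s in \<mu>. indicator {0..0} s *\<^sub>R h s = 0"
    by eventually_elim simp
  then show ?case
    unfolding set_lebesgue_integral_def by (rule integral_eq_zero_AE)
next
  case (2 s t c e)
  interpret finite_measure \<mu> by (rule finite_energy_measure)
  have st: "s \<in> {0..T}" "t \<in> {0..T}" "0 \<in> {0..T}" "s \<le> t"
    using 2 by auto
  have int: "set_integrable \<mu> {s<..t} k" if "continuous_on {0..T} k" for k :: "real \<Rightarrow> real"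
    using that Ioc_in_sets[OF st(1,2)] by (rule set_integrable_continuous)
  have const: "(LINT u:{s<..t}|\<mu>. k) = k * (A t - A s)" for k :: real
    using set_integral_const[OF Ioc_in_sets[OF st(1,2)], of k] measure_Ioc[of s t] 2 by simp
  have "{0..t} = {0..s} \<union> {s<..t}"
    using 2 by auto
  then have "(LINT u:{0..t}|\<mu>. h u) = (LINT u:{0..s}|\<mu>. h u) + (LINT u:{s<..t}|\<mu>. h u)"
    using set_integral_Un[of "{0..s}" "{s<..t}" \<mu> h] int[OF h]
      set_integrable_continuous[OF h Icc_in_sets[OF st(3,1)]] by (simp add: ivl_disj_int)
  then have diff: "(LINT u:{0..t}|\<mu>. h u) - (LINT u:{0..s}|\<mu>. h u) = (LINT u:{s<..t}|\<mu>. h u)"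
    by simp
  have "(c - e) * (A t - A s) \<le> (LINT u:{s<..t}|\<mu>. h u)"
    unfolding const[symmetric] using 2
    by (intro set_integral_mono int h continuous_on_const) (auto simp: abs_le_iff algebra_simps)
  moreover have "(LINT u:{s<..t}|\<mu>. h u) \<le> (c + e) * (A t - A s)"
    unfolding const[symmetric] using 2
    by (intro set_integral_mono int h continuous_on_const) (auto simp: abs_le_iff algebra_simps)
  ultimately show ?case
    unfolding diff by (simp add: abs_le_iff algebra_simps)
qed

lemma continuous_on_abs_powr:
  assumes "0 < p" "continuous_on {0..T} g"
  shows "continuous_on {0..T} (\<lambda>s. \<bar>g s\<bar> powr p)"
  using assms by (intro continuous_on_powr' continuous_intros) auto

lemma stieltjes_primitive_weighted_energy:
  assumes "0 < p" "continuous_on {0..T} g"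
  shows "stieltjes_primitive T A (\<lambda>s. \<bar>g s\<bar> powr p) (weighted_energy p T x g)"
  using stieltjes_primitive_integral[OF continuous_on_abs_powr[OF assms]]
  by (simp add: weighted_energy_def[abs_def])

lemma has_limiting_energy_of_remainder:
  assumes "0 < p" "continuous_on {0..T} y" "continuous_on {0..T} g" "remainder_vanishes p T y x g"
  shows "has_limiting_energy p T y (weighted_energy p T x g)"
  unfolding has_limiting_energy_def
proof (intro conjI)
  note B = stieltjes_primitive_weighted_energy[OF assms(1,3)]
  show "continuous_on {0..T} (weighted_energy p T x g)"
    using B A_continuous continuous_on_abs_powr[OF assms(1,3)] by (rule stieltjes_primitive_continuous)
  show "mono_on {0..T} (weighted_energy p T x g)"
    using B A_mono continuous_on_abs_powr[OF assms(1,3)] by (rule stieltjes_primitive_mono) simp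
  show "weighted_energy p T x g 0 = 0"
    using B by (simp add: stieltjes_primitive_def)
  show "energy_converges p T y (weighted_energy p T x g)"
    by (rule energy_converges_of_remainder[OF horizon assms(1) energy assms(3,4) B])
qed fact

text \<open>Both measures give \<open>{0..t}\<close> the mass
  \<open>weighted_energy p T x g t\<close>, and these values determine a finite measure on
  \<open>{0..T}\<close>.\<close>

lemma energy_measure_eq_density:
  assumes "0 < p" "continuous_on {0..T} g" "has_limiting_energy p T y (weighted_energy p T x g)"
  shows "energy_measure p T y = density \<mu> (\<lambda>s. ennreal (\<bar>g s\<bar> powr p))"
proof (rule measure_eqI_Icc[of _ T])
  let ?h = "\<lambda>s. \<bar>g s\<bar> powr p"
  show "sets (energy_measure p T y) = sets (restrict_space borel {0..T})"
    by (rule sets_energy_measure)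
  show "sets (density \<mu> (\<lambda>s. ennreal (?h s))) = sets (restrict_space borel {0..T})"
    by (simp add: sets_energy_measure)
  fix t assume t: "t \<in> {0..T}"
  have em: "emeasure (energy_measure p T y) {0..t} = ennreal (weighted_energy p T x g t)"
    by (rule emeasure_energy_measure[OF horizon assms(3) t])
  then show "emeasure (energy_measure p T y) {0..t} < \<infinity>"
    by simp
  have h: "?h \<in> borel_measurable \<mu>"
    using borel_measurable_continuous_on_restrict[OF continuous_on_abs_powr[OF assms(1,2)]]
    by (simp cong: measurable_cong_sets add: sets_energy_measure)
  have I: "{0..t} \<in> sets \<mu>"
    using t horizon by (intro Icc_in_sets) auto
  have "emeasure (density \<mu> (\<lambda>s. ennreal (?h s))) {0..t} = (\<integral>\<^sup>+ s. ennreal (indicator {0..t} s *\<^sub>R ?h s) \<partial>\<mu>)"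
    using h I by (subst emeasure_density) (auto intro!: nn_integral_cong split: split_indicator)
  also have "\<dots> = ennreal (weighted_energy p T x g t)"
    unfolding weighted_energy_def set_lebesgue_integral_def
    using set_integrable_continuous[OF continuous_on_abs_powr[OF assms(1,2)] I]
    by (intro nn_integral_eq_integral) (auto simp: set_integrable_def)
  finally show "emeasure (energy_measure p T y) {0..t} = emeasure (density \<mu> (\<lambda>s. ennreal (?h s))) {0..t}"
    using em by simp
qed

lemma weighted_energy_one:
  assumes "t \<in> {0..T}"
  shows "weighted_energy p T x (\<lambda>s. 1) t = A t"
proof -
  interpret finite_measure \<mu> by (rule finite_energy_measure)
  show ?thesis
    using assms horizon set_integral_const[OF Icc_in_sets[of 0 t], of "1 :: real"] measure_Icc
    by (simp add: weighted_energy_def)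
qed

lemma weighted_energy_lower_bound:
  assumes "0 < p" "continuous_on {0..T} g" "0 < c" "\<And>s. s \<in> {0..T} \<Longrightarrow> c \<le> \<bar>g s\<bar>"
  shows "c powr p * A T \<le> weighted_energy p T x g T"
proof -
  interpret finite_measure \<mu> by (rule finite_energy_measure)
  have I: "{0..T} \<in> sets \<mu>"
    using horizon by (intro Icc_in_sets) auto
  have "c powr p * A T = (LINT s:{0..T}|\<mu>. c powr p)"
    using set_integral_const[OF I, of "c powr p"] measure_Icc[of T] horizon by simp
  also have "\<dots> \<le> (LINT s:{0..T}|\<mu>. \<bar>g s\<bar> powr p)"
    using assms
    by (intro set_integral_mono set_integrable_continuous[OF _ I] continuous_on_abs_powr continuous_on_const)
      (auto intro!: powr_mono2)
  finally show ?thesis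
    by (simp add: weighted_energy_def)
qed

text \<open>Relative Lipschitz continuity and telescoping of \<open>A\<close> bound the variation by
  \<open>\<bar>c\<bar> * (M * A T)\<close>. The affine form matches the correction term of the
  compensated integral.\<close>

lemma finite_variation_primitive:
  assumes "continuous_on {0..T} h" "stieltjes_primitive T A h B"
  shows "finite_variation T (\<lambda>t. a + c * B t)"
  unfolding finite_variation_def
proof -
  have "bounded (h ` {0..T})"
    using assms(1) by (intro compact_imp_bounded compact_continuous_image) auto
  then obtain M where M: "\<forall>y\<in>h ` {0..T}. norm y \<le> M"
    unfolding bounded_iff ..
  show "\<exists>C. \<forall>lam. finite lam \<and> {0, T} \<subseteq> lam \<and> lam \<subseteq> {0..T} \<longrightarrow>
      (\<Sum>i<card lam - 1. \<bar>a + c * B (partition_point lam (Suc i)) - (a + c * B (partition_point lam i))\<bar>) \<le> C"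
  proof (intro exI allI impI)
    fix lam :: "real set" assume "finite lam \<and> {0, T} \<subseteq> lam \<and> lam \<subseteq> {0..T}"
    then interpret time_partition T lam by unfold_locales auto
    let ?v = "partition_point lam" and ?n = "card lam - 1"
    have "(\<Sum>i<?n. \<bar>a + c * B (?v (Suc i)) - (a + c * B (?v i))\<bar>) \<le> (\<Sum>i<?n. \<bar>c\<bar> * (M * (A (?v (Suc i)) - A (?v i))))"
    proof (rule sum_mono)
      fix i assume i: "i \<in> {..<?n}"
      have "\<bar>B (?v (Suc i)) - B (?v i)\<bar> \<le> M * (A (?v (Suc i)) - A (?v i))"
        using point_in_interval[of i] point_in_interval[of "Suc i"] point_mono[of i "Suc i"] i M
        by (intro stieltjes_primitive_lipschitz[OF assms(2)]) auto
      then have "\<bar>c\<bar> * \<bar>B (?v (Suc i)) - B (?v i)\<bar> \<le> \<bar>c\<bar> * (M * (A (?v (Suc i)) - A (?v i)))"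
        by (intro mult_left_mono) auto
      moreover have "a + c * B (?v (Suc i)) - (a + c * B (?v i)) = c * (B (?v (Suc i)) - B (?v i))"
        by (simp add: algebra_simps)
      ultimately show "\<bar>a + c * B (?v (Suc i)) - (a + c * B (?v i))\<bar> \<le> \<bar>c\<bar> * (M * (A (?v (Suc i)) - A (?v i)))"
        by (simp add: abs_mult)
    qed
    also have "\<dots> = \<bar>c\<bar> * (M * (\<Sum>i<?n. A (?v (Suc i)) - A (?v i)))"
      by (simp add: sum_distrib_left)
    also have "\<dots> = \<bar>c\<bar> * (M * A T)"
      using sum_lessThan_telescope[of "\<lambda>i. A (?v i)" ?n] by (simp only: point_0 point_last A_0) simp
    finally show "(\<Sum>i<?n. \<bar>a + c * B (?v (Suc i)) - (a + c * B (?v i))\<bar>) \<le> \<bar>c\<bar> * (M * A T)" .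
  qed
qed

section \<open>Smooth functions of a rough path\<close>

lemma C1_remainder_vanishes:
  assumes p: "0 < p" and U: "open U" "x ` {0..T} \<subseteq> U" and F: "F C1_differentiable_on U"
  shows "remainder_vanishes p T (F \<circ> x) x (deriv F \<circ> x)" and "continuous_on {0..T} (F \<circ> x)"
    and "continuous_on {0..T} (deriv F \<circ> x)"
proof -
  obtain D where D: "\<And>u. u \<in> U \<Longrightarrow> (F has_real_derivative D u) (at u)" "continuous_on U D"
    using F unfolding C1_differentiable_on_def has_real_derivative_iff_has_vector_derivative by blast
  have deriv: "deriv F u = D u" if "u \<in> U" for u
    using D(1)[OF that] by (rule DERIV_imp_deriv)
  have F_cont: "continuous_on U F"
    using D(1) by (intro continuous_at_imp_continuous_on ballI DERIV_isCont) auto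
  show "continuous_on {0..T} (F \<circ> x)"
    using x_continuous F_cont U(2) by (intro continuous_on_compose) (auto intro: continuous_on_subset)
  have "continuous_on U (deriv F)"
    using D(2) deriv by (simp cong: continuous_on_cong)
  then show "continuous_on {0..T} (deriv F \<circ> x)"
    using x_continuous U(2) by (intro continuous_on_compose) (auto intro: continuous_on_subset)
  \<comment> \<open>The image of \<open>{0..T}\<close> is connected, hence convex on the line:
    segments between values of \<open>x\<close> stay in \<open>K\<close> even when \<open>U\<close>
    has several components.\<close>
  define K where "K = x ` {0..T}"
  have K: "compact K" "K \<subseteq> U" "convex K"
    using x_continuous U(2) unfolding K_def
    by (auto intro!: compact_continuous_image connected_continuous_image
        simp: is_interval_convex_1[symmetric] is_interval_connected_1)
  have D_K: "continuous_on K D"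
    using D(2) K(2) by (rule continuous_on_subset)
  show "remainder_vanishes p T (F \<circ> x) x (deriv F \<circ> x)"
  proof (rule remainder_vanishes_first_order[OF horizon p x_converges])
    show "A t \<le> A T" if "t \<in> {0..T}" for t
      using A_le that by simp
    fix e :: real assume e: "0 < e"
    obtain r where r: "0 < r" "\<forall>u\<in>K. \<forall>w\<in>K. \<bar>w - u\<bar> < r \<longrightarrow> \<bar>D w - D u\<bar> < e"
      using continuous_on_compact_modulus[OF D_K K(1) e] .
    obtain d where d: "0 < d" "\<forall>s\<in>{0..T}. \<forall>t\<in>{0..T}. \<bar>t - s\<bar> < d \<longrightarrow> \<bar>x t - x s\<bar> < r"
      using continuous_on_compact_modulus[OF x_continuous compact_Icc r(1)] .
    show "\<exists>d>0. \<forall>s\<in>{0..T}. \<forall>t\<in>{0..T}. \<bar>t - s\<bar> < d \<longrightarrow>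
        \<bar>(F \<circ> x) t - (F \<circ> x) s - (deriv F \<circ> x) s * (x t - x s)\<bar> \<le> e * \<bar>x t - x s\<bar>"
    proof (intro exI[of _ d] conjI ballI impI)
      fix s t assume st: "s \<in> {0..T}" "t \<in> {0..T}" "\<bar>t - s\<bar> < d"
      have K_st: "x s \<in> K" "x t \<in> K"
        using st by (auto simp: K_def)
      have seg: "closed_segment (x s) (x t) \<subseteq> K"
        using K_st K(3) by (rule closed_segment_subset)
      have close: "\<bar>x t - x s\<bar> < r"
        using d(2) st by blast
      \<comment> \<open>The mean value theorem for \<open>F\<close> minus its linear part at
        \<open>x s\<close>, whose derivative \<open>D u - D (x s)\<close> is below \<open>e\<close>
        along the segment.\<close>
      have "norm ((F (x t) - D (x s) * x t) - (F (x s) - D (x s) * x s)) \<le> e * norm (x t - x s)"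
      proof (rule field_differentiable_bound[where S="closed_segment (x s) (x t)" and f'="\<lambda>u. D u - D (x s)"])
        fix u assume u: "u \<in> closed_segment (x s) (x t)"
        then have "u \<in> K" using seg by blast
        then show "((\<lambda>u. F u - D (x s) * u) has_field_derivative D u - D (x s)) (at u within closed_segment (x s) (x t))"
          using K(2) by (auto intro!: derivative_eq_intros DERIV_subset[OF D(1)])
        have "\<bar>u - x s\<bar> \<le> \<bar>x t - x s\<bar>"
          using segment_bound(1)[OF u] by simp
        then show "norm (D u - D (x s)) \<le> e"
          using r(2) K_st(1) \<open>u \<in> K\<close> close by (simp add: less_imp_le)
      qed auto
      moreover have "D (x s) = deriv F (x s)"
        using deriv K(2) K_st by auto
      ultimately show "\<bar>(F \<circ> x) t - (F \<circ> x) s - (deriv F \<circ> x) s * (x t - x s)\<bar> \<le> e * \<bar>x t - x s\<bar>"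
        by (simp add: algebra_simps)
    qed fact
  qed
qed

end

section \<open>Taylor expansion and the compensated integral\<close>

lemma C_k_DERIV:
  assumes "C_k k f" "j < k"
  shows "((deriv ^^ j) f has_real_derivative (deriv ^^ Suc j) f u) (at u)"
  using assms by (simp add: C_k_def DERIV_deriv_iff_field_differentiable)

lemma C_k_continuous:
  assumes "C_k k f" "j \<le> k"
  shows "continuous_on UNIV ((deriv ^^ j) f)"
proof (cases "j = k")
  case False
  then show ?thesis
    using assms(2) by (intro continuous_at_imp_continuous_on ballI DERIV_isCont[OF C_k_DERIV[OF assms(1)]]) auto
qed (use assms in \<open>simp add: C_k_def\<close>)

text \<open>In the Lagrange remainder the top derivative is evaluated at an intermediate point;
  uniform continuity on the compact interval moves it to \<open>u\<close>, with one \<open>d\<close>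
  for all pairs.\<close>

lemma C_k_Taylor:
  assumes f: "C_k q f" and q: "0 < q" and e: "0 < e"
  obtains d where "0 < d" "\<forall>u\<in>{-R..R}. \<forall>w\<in>{-R..R}. \<bar>w - u\<bar> < d \<longrightarrow>
    \<bar>f w - (\<Sum>m\<le>q. (deriv ^^ m) f u / fact m * (w - u) ^ m)\<bar> \<le> e * \<bar>w - u\<bar> ^ q"
proof -
  let ?D = "\<lambda>m. (deriv ^^ m) f"
  have "continuous_on {-R..R} (?D q)"
    using C_k_continuous[OF f order_refl] by (rule continuous_on_subset) simp
  then obtain d where d: "0 < d" "\<forall>u\<in>{-R..R}. \<forall>w\<in>{-R..R}. \<bar>w - u\<bar> < d \<longrightarrow> \<bar>?D q w - ?D q u\<bar> < e"
    using continuous_on_compact_modulus[OF _ compact_Icc e] by blast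
  have "\<bar>f w - (\<Sum>m\<le>q. ?D m u / fact m * (w - u) ^ m)\<bar> \<le> e * \<bar>w - u\<bar> ^ q"
    if uw: "u \<in> {-R..R}" "w \<in> {-R..R}" "\<bar>w - u\<bar> < d" for u w
  proof (cases "w = u")
    case True
    \<comment> \<open>Only the term \<open>m = 0\<close> survives, as
      \<open>0 ^ 0 = 1\<close>.\<close>
    have "(\<Sum>m\<le>q. ?D m u / fact m * 0 ^ m) = f u"
      by (subst sum.atMost_shift) simp
    then show ?thesis
      using True q e by simp
  next
    case False
    have "\<exists>r. (if w < u then w < r \<and> r < u else u < r \<and> r < w) \<and>
        f w = (\<Sum>m<q. ?D m u / fact m * (w - u) ^ m) + ?D q r / fact q * (w - u) ^ q"
      using uw False q C_k_DERIV[OF f] by (intro Taylor[where a="-R" and b=R]) auto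
    then obtain r where r: "if w < u then w < r \<and> r < u else u < r \<and> r < w"
      "f w = (\<Sum>m<q. ?D m u / fact m * (w - u) ^ m) + ?D q r / fact q * (w - u) ^ q"
      by (elim exE conjE)
    have "r \<in> {-R..R}" "\<bar>r - u\<bar> < d"
      using r(1) uw by (auto split: if_splits)
    then have "\<bar>?D q r - ?D q u\<bar> \<le> e"
      using d(2) uw(1) less_imp_le by blast
    moreover have "f w - (\<Sum>m\<le>q. ?D m u / fact m * (w - u) ^ m) = (?D q r - ?D q u) * (w - u) ^ q / fact q"
      unfolding r(2) lessThan_Suc_atMost[symmetric] by (simp add: diff_divide_distrib algebra_simps)
    moreover have "\<bar>?D q r - ?D q u\<bar> * \<bar>w - u\<bar> ^ q / fact q \<le> \<bar>?D q r - ?D q u\<bar> * \<bar>w - u\<bar> ^ q / 1"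
      by (intro divide_left_mono) (auto simp: fact_ge_1)
    ultimately show ?thesis
      using mult_right_mono[of "\<bar>?D q r - ?D q u\<bar>" e "\<bar>w - u\<bar> ^ q"] by (simp add: abs_mult power_abs)
  qed
  then show ?thesis
    using that[OF d(1)] by blast
qed

text \<open>In the Taylor polynomial the degrees \<open>1\<close> to \<open>q - 1\<close> form the
  compensated sum. For even \<open>q\<close> the top power is
  \<open>\<bar>\<Delta>\<bar> powr p\<close>, so the top degree is a weighted energy sum with the
  possibly signed weight \<open>(deriv ^^ q) f \<circ> x\<close>.\<close>

lemma (in limiting_energy_path) compensated_sums_converge:
  fixes f :: "real \<Rightarrow> real"
  assumes q: "2 \<le> q" "even q" "p = real q" and f: "C_k q f"
  shows "uniform_limit {0..T} (compensated_sum q f x)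
    (\<lambda>t. f (x t) - f (x 0) - 1 / fact q * (LINT s:{0..t}|\<mu>. (deriv ^^ q) f (x s))) (fine_grids T)"
proof (rule uniform_limitI)
  fix e :: real assume e: "0 < e"
  let ?D = "\<lambda>m. (deriv ^^ m) f"
  have "continuous_on {0..T} (?D q \<circ> x)"
    using x_continuous C_k_continuous[OF f order_refl]
    by (intro continuous_on_compose) (auto intro: continuous_on_subset)
  then have h: "continuous_on {0..T} (\<lambda>s. ?D q (x s))"
    by (simp add: comp_def)
  let ?B = "\<lambda>t. LINT s:{0..t}|\<mu>. ?D q (x s)"
  have W: "uniform_limit {0..T} (\<lambda>lam t. \<Sum>i<card lam - 1. ?D q (x (partition_point lam i))
      * \<bar>stopped_increment lam x t i\<bar> powr p) ?B (fine_grids T)"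
    by (rule weighted_energy_sums_converge[OF horizon energy h stieltjes_primitive_integral[OF h]])
  have "bounded (x ` {0..T})"
    using x_continuous by (intro compact_imp_bounded compact_continuous_image) auto
  then obtain R where R: "\<forall>y\<in>x ` {0..T}. norm y \<le> R"
    unfolding bounded_iff ..
  have x_R: "x s \<in> {-R..R}" if "s \<in> {0..T}" for s
  proof -
    have "\<bar>x s\<bar> \<le> R" using R that by simp
    then show ?thesis by auto
  qed
  \<comment> \<open>Multiplied by the eventual energy bound \<open>A T + 1\<close>, the Taylor
    errors total at most \<open>e / 4\<close>.\<close>
  define c where "c = e / (4 * (A T + 1))"
  have A_T: "0 \<le> A T" using A_nonneg[of T] horizon by simp
  then have c: "0 < c" "c * (A T + 1) = e / 4"
    using e by (auto simp: c_def field_simps add_nonneg_eq_0_iff)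
  obtain r where r: "0 < r" "\<forall>u\<in>{-R..R}. \<forall>w\<in>{-R..R}. \<bar>w - u\<bar> < r \<longrightarrow>
      \<bar>f w - (\<Sum>m\<le>q. ?D m u / fact m * (w - u) ^ m)\<bar> \<le> c * \<bar>w - u\<bar> ^ q"
    using C_k_Taylor[OF f _ c(1), of R] q(1) by auto
  obtain d where d: "0 < d" "\<forall>s\<in>{0..T}. \<forall>t\<in>{0..T}. \<bar>t - s\<bar> < d \<longrightarrow> \<bar>x t - x s\<bar> < r"
    using continuous_on_compact_modulus[OF x_continuous compact_Icc r(1)] .
  have "\<forall>\<^sub>F lam in fine_grids T. \<forall>t\<in>{0..T}. stopped_energy p lam x t \<le> A T + 1"
    using A_le by (intro uniform_limit_bounded_eventually[OF x_converges[unfolded energy_converges_iff]]) simp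
  moreover have "\<forall>\<^sub>F lam in fine_grids T. \<forall>t\<in>{0..T}. dist (\<Sum>i<card lam - 1. ?D q (x (partition_point lam i))
      * \<bar>stopped_increment lam x t i\<bar> powr p) (?B t) < e / 2"
    using W by (rule uniform_limitD) (use e in simp)
  ultimately show "\<forall>\<^sub>F lam in fine_grids T. \<forall>t\<in>{0..T}.
      dist (compensated_sum q f x lam t) (f (x t) - f (x 0) - 1 / fact q * ?B t) < e"
    using eventually_partition_fine_grids[OF horizon] eventually_gap_fine_grids[OF horizon d(1)]
  proof eventually_elim
    case (elim lam)
    interpret time_partition T lam by fact
    let ?v = "partition_point lam" and ?n = "card lam - 1"
    show ?case
    proof
      fix t assume t: "t \<in> {0..T}"
      let ?\<Delta> = "stopped_increment lam x t"
      let ?S = "\<Sum>i<?n. ?D q (x (?v i)) * \<bar>?\<Delta> i\<bar> powr p"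
      let ?C = "\<lambda>i. \<Sum>j = 1..q - 1. ?D j (x (?v i)) / fact j * ?\<Delta> i ^ j"
      \<comment> \<open>The Taylor remainder on the stopped cell; in the sum over \<open>i\<close>
        the increments of \<open>f \<circ> x\<close> telescope.\<close>
      let ?R = "\<lambda>i. f (x (min (?v (Suc i)) t)) - f (x (min (?v i) t))
        - (?C i + ?D q (x (?v i)) / fact q * \<bar>?\<Delta> i\<bar> powr p)"
      have powr_q: "\<bar>u\<bar> powr p = \<bar>u\<bar> ^ q" "\<bar>u\<bar> powr p = u ^ q" for u :: real
        using q powr_realpow[of "\<bar>u\<bar>" q] by (cases "u = 0"; simp add: power_even_abs)+
      have R_i: "\<bar>?R i\<bar> \<le> c * \<bar>?\<Delta> i\<bar> powr p" if i: "i < ?n" for i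
      proof (cases "?v i \<le> t")
        case True
        let ?u = "x (?v i)" and ?w = "x (min (?v (Suc i)) t)"
        have \<Delta>: "?\<Delta> i = ?w - ?u"
          using True by (simp add: stopped_increment_def min_absorb1)
        have sp: "?v i \<in> {0..T}" "min (?v (Suc i)) t \<in> {0..T}" "\<bar>min (?v (Suc i)) t - ?v i\<bar> < d"
          using stopped_points[OF i t] elim(4) i True by (auto simp: min_absorb1)
        have "\<bar>?w - ?u\<bar> < r"
          using d(2) sp by blast
        then have "\<bar>f ?w - (\<Sum>m\<le>q. ?D m ?u / fact m * (?w - ?u) ^ m)\<bar> \<le> c * \<bar>?w - ?u\<bar> ^ q"
          using r(2) x_R[OF sp(1)] x_R[OF sp(2)] by blast
        moreover have "(\<Sum>m\<le>q. ?D m ?u / fact m * (?w - ?u) ^ m)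
            = f ?u + ?C i + ?D q ?u / fact q * (?w - ?u) ^ q"
        proof -
          have "{..q} = insert 0 (insert q {1..q - 1})"
            using q(1) by auto
          then show ?thesis
            using q(1) by (simp add: \<Delta>)
        qed
        ultimately have "\<bar>f ?w - f ?u - (?C i + ?D q ?u / fact q * ?\<Delta> i ^ q)\<bar> \<le> c * \<bar>?\<Delta> i\<bar> ^ q"
          by (simp add: \<Delta> algebra_simps)
        then show ?thesis
          using True unfolding powr_q(2)[of "?\<Delta> i"] powr_q(1)[symmetric, of "?\<Delta> i"] by (simp add: powr_q(2) min_absorb1)
      next
        case False
        moreover have "?v i \<le> ?v (Suc i)" using i by (intro point_mono) auto
        ultimately show ?thesis by (simp add: stopped_increment_def min_absorb2 power_0_left)
      qed
      have "\<bar>\<Sum>i<?n. ?R i\<bar> \<le> (\<Sum>i<?n. c * \<bar>?\<Delta> i\<bar> powr p)"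
        using R_i by (intro order_trans[OF sum_abs] sum_mono) auto
      also have "\<dots> = c * stopped_energy p lam x t"
        by (simp add: stopped_energy_def sum_distrib_left)
      also have "\<dots> \<le> e / 4"
        unfolding c(2)[symmetric] using elim(1) t c(1) by (intro mult_left_mono) auto
      finally have rem: "\<bar>\<Sum>i<?n. ?R i\<bar> \<le> e / 4" .
      have "(\<Sum>i<?n. ?R i) = f (x t) - f (x 0) - (compensated_sum q f x lam t + 1 / fact q * ?S)"
        using sum_stopped_differences[OF t, of "\<lambda>s. f (x s)"]
        by (simp add: sum_subtractf sum.distrib compensated_sum_def sum_distrib_left)
      then have "compensated_sum q f x lam t - (f (x t) - f (x 0) - 1 / fact q * ?B t)
          = - (\<Sum>i<?n. ?R i) - 1 / fact q * (?S - ?B t)"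
        by (simp add: algebra_simps)
      then have "\<bar>compensated_sum q f x lam t - (f (x t) - f (x 0) - 1 / fact q * ?B t)\<bar>
          \<le> \<bar>\<Sum>i<?n. ?R i\<bar> + \<bar>1 / fact q * (?S - ?B t)\<bar>"
        using abs_triangle_ineq4[of "- (\<Sum>i<?n. ?R i)" "1 / fact q * (?S - ?B t)"] by simp
      also have "\<dots> < e / 4 + e / 2"
      proof (rule add_le_less_mono[OF rem])
        have "\<bar>1 / fact q * (?S - ?B t)\<bar> \<le> 1 * \<bar>?S - ?B t\<bar>"
          unfolding abs_mult by (intro mult_right_mono) (auto simp: fact_ge_1)
        also have "\<dots> < e / 2"
          using elim(2) t by (simp add: dist_real_def)
        finally show "\<bar>1 / fact q * (?S - ?B t)\<bar> < e / 2" .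
      qed
      finally show "dist (compensated_sum q f x lam t) (f (x t) - f (x 0) - 1 / fact q * ?B t) < e"
        unfolding dist_real_def by (rule order.strict_trans) (use e in simp)
    qed
  qed
qed

lemma (in limiting_energy_path) compensated_remainder_vanishes:
  fixes f :: "real \<Rightarrow> real"
  assumes q: "2 \<le> q" "p = real q" and f: "C_k q f"
  defines "Y \<equiv> \<lambda>t. f (x t) - f (x 0) - 1 / fact q * (LINT s:{0..t}|\<mu>. (deriv ^^ q) f (x s))"
  shows "remainder_vanishes p T Y x (deriv f \<circ> x)" and "continuous_on {0..T} Y"
    and "continuous_on {0..T} (deriv f \<circ> x)"
proof -
  have p: "0 < p" "1 < p" using q by auto
  have f_C1: "f C1_differentiable_on UNIV"
    unfolding C1_differentiable_on_def
  proof (intro exI conjI ballI)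
    show "continuous_on UNIV (deriv f)"
      using C_k_continuous[OF f, of 1] q by simp
    show "(f has_vector_derivative deriv f u) (at u)" for u
      using C_k_DERIV[OF f, of 0 u] q by (simp add: has_real_derivative_iff_has_vector_derivative)
  qed
  note C1 = C1_remainder_vanishes[OF p(1) open_UNIV subset_UNIV f_C1]
  show "continuous_on {0..T} (deriv f \<circ> x)"
    by (rule C1(3))
  have "continuous_on {0..T} ((deriv ^^ q) f \<circ> x)"
    using x_continuous C_k_continuous[OF f order_refl]
    by (intro continuous_on_compose) (auto intro: continuous_on_subset)
  then have h: "continuous_on {0..T} (\<lambda>s. (deriv ^^ q) f (x s))"
    by (simp add: comp_def)
  note B = stieltjes_primitive_integral[OF h]
  \<comment> \<open>Collects the initial value and the integral term, so that \<open>Y\<close> is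
    \<open>f \<circ> x\<close> plus a continuous path of finite variation.\<close>
  define z where "z = (\<lambda>t. - f (x 0) + (- 1 / fact q) * (LINT s:{0..t}|\<mu>. (deriv ^^ q) f (x s)))"
  have Y: "Y = (\<lambda>t. (f \<circ> x) t + z t)"
    by (simp add: Y_def z_def fun_eq_iff)
  have z: "continuous_on {0..T} z"
    unfolding z_def by (intro continuous_intros stieltjes_primitive_continuous[OF B A_continuous h])
  have "finite_variation T z"
    unfolding z_def by (rule finite_variation_primitive[OF h B])
  then have "energy_converges p T z (\<lambda>t. 0)"
    by (rule finite_variation_energy[OF horizon p(2) z])
  then show "remainder_vanishes p T Y x (deriv f \<circ> x)"
    unfolding Y by (rule remainder_vanishes_add[OF p(1) C1(1)])
  show "continuous_on {0..T} Y"
    unfolding Y by (intro continuous_on_add C1(2) z)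
qed

section \<open>Assembly of the general statement and its three cases\<close>

lemma remainder_vanishes_self: "remainder_vanishes p T x x (\<lambda>s. 1)"
  unfolding remainder_vanishes_iff by (simp add: uniform_limit_const)

lemma rough_pathsI: "has_limiting_energy p T y B \<Longrightarrow> 0 < B T \<Longrightarrow> y \<in> rough_paths p T"
  unfolding rough_paths_def by blast

text \<open>Used in both directions: \<open>B T = 0\<close> forces \<open>B\<close> to vanish on
  \<open>{0..T}\<close>, and a nonzero value at any time forces \<open>B T > 0\<close>.\<close>

lemma has_limiting_energy_bounds:
  assumes "0 < T" "has_limiting_energy p T y B" "t \<in> {0..T}"
  shows "0 \<le> B t" "B t \<le> B T"
proof -
  interpret limiting_energy_path p T y B
    using assms by unfold_locales
  show "0 \<le> B t" "B t \<le> B T"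
    using A_nonneg A_le assms(3) by auto
qed

theorem proposition3p10:
  fixes p T :: real and x :: "real \<Rightarrow> real"
  assumes "p > 1" and "T > 0" and "x \<in> rough_paths p T"
  shows
    "(\<forall>y g :: real \<Rightarrow> real.
        continuous_on {0..T} y \<and> continuous_on {0..T} g \<and> remainder_vanishes p T y x g \<longrightarrow>
          energy_converges p T y (weighted_energy p T x g) \<and>
          (weighted_energy p T x g T > 0 \<longrightarrow>
             y \<in> rough_paths p T \<and>
             energy_measure p T y = density (energy_measure p T x) (\<lambda>s. ennreal (\<bar>g s\<bar> powr p)) \<and>
             (\<forall>t\<in>{0..T}. limiting_energy p T y t = weighted_energy p T x g t)) \<and>
          (weighted_energy p T x g T = 0 \<longrightarrow>
             has_limiting_energy p T y (\<lambda>t. 0) \<and> y \<notin> rough_paths p T))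
     \<and>
     (\<forall>(F :: real \<Rightarrow> real) (U :: real set).
        open U \<and> x ` {0..T} \<subseteq> U \<and> F C1_differentiable_on U \<longrightarrow>
          remainder_vanishes p T (F \<circ> x) x (deriv F \<circ> x) \<and>
          has_limiting_energy p T (F \<circ> x) (weighted_energy p T x (deriv F \<circ> x)) \<and>
          (\<forall>t\<in>{0..T}. limiting_energy p T (F \<circ> x) t = weighted_energy p T x (deriv F \<circ> x) t) \<and>
          (weighted_energy p T x (deriv F \<circ> x) T > 0 \<longrightarrow> F \<circ> x \<in> rough_paths p T) \<and>
          ((\<exists>c>0. \<forall>u\<in>x ` {0..T}. c \<le> \<bar>deriv F u\<bar>) \<longrightarrow>
             weighted_energy p T x (deriv F \<circ> x) T > 0 \<and> F \<circ> x \<in> rough_paths p T))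
     \<and>
     (\<forall>z :: real \<Rightarrow> real. continuous_on {0..T} z \<longrightarrow>
        (energy_converges p T z (\<lambda>t. 0) \<longrightarrow>
           (\<lambda>t. x t + z t) \<in> rough_paths p T \<and>
           energy_measure p T (\<lambda>t. x t + z t) = energy_measure p T x) \<and>
        (finite_variation T z \<longrightarrow> energy_converges p T z (\<lambda>t. 0)) \<and>
        ((\<exists>\<alpha>>1 / p. holder_on \<alpha> {0..T} z) \<longrightarrow> energy_converges p T z (\<lambda>t. 0)))
     \<and>
     (\<forall>(q :: nat) (f :: real \<Rightarrow> real).
        q \<ge> 2 \<and> even q \<and> p = real q \<and> C_k q f \<longrightarrow>
          (let Y = (\<lambda>t. f (x t) - f (x 0)
                 - 1 / fact q * (LINT s:{0..t}|energy_measure p T x. (deriv ^^ q) f (x s))) in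
             (\<forall>l a :: nat \<Rightarrow> real.
                (\<forall>n. 0 < l n \<and> l n \<le> T \<and> 0 \<le> a n \<and> a n < l n) \<and>
                (\<lambda>n. mesh (uniform_grid T (l n) (a n))) \<longlonglongrightarrow> 0 \<longrightarrow>
                (\<forall>t\<in>{0..T}. has_compensated_integral q f x (\<lambda>n. uniform_grid T (l n) (a n)) t (Y t))) \<and>
             remainder_vanishes p T Y x (deriv f \<circ> x) \<and>
             has_limiting_energy p T Y (weighted_energy p T x (deriv f \<circ> x)) \<and>
             (\<forall>t\<in>{0..T}. limiting_energy p T Y t = weighted_energy p T x (deriv f \<circ> x) t) \<and>
             ((\<exists>t\<in>{0..T}. weighted_energy p T x (deriv f \<circ> x) t \<noteq> 0) \<longrightarrow> Y \<in> rough_paths p T)))"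
proof (intro conjI)
  have p: "0 < p" using assms(1) by simp
  obtain A where A: "has_limiting_energy p T x A" "0 < A T"
    using assms(3) unfolding rough_paths_def by blast
  interpret limiting_energy_path p T x A
    using assms(2) A(1) by unfold_locales
  note eq = limiting_energy_eq[OF assms(2)]

  show "\<forall>y g :: real \<Rightarrow> real.
        continuous_on {0..T} y \<and> continuous_on {0..T} g \<and> remainder_vanishes p T y x g \<longrightarrow>
          energy_converges p T y (weighted_energy p T x g) \<and>
          (weighted_energy p T x g T > 0 \<longrightarrow>
             y \<in> rough_paths p T \<and>
             energy_measure p T y = density (energy_measure p T x) (\<lambda>s. ennreal (\<bar>g s\<bar> powr p)) \<and>
             (\<forall>t\<in>{0..T}. limiting_energy p T y t = weighted_energy p T x g t)) \<and>
          (weighted_energy p T x g T = 0 \<longrightarrow>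
             has_limiting_energy p T y (\<lambda>t. 0) \<and> y \<notin> rough_paths p T)"
  proof (intro allI impI)
    fix y g :: "real \<Rightarrow> real"
    assume *: "continuous_on {0..T} y \<and> continuous_on {0..T} g \<and> remainder_vanishes p T y x g"
    let ?B = "weighted_energy p T x g"
    have B: "has_limiting_energy p T y ?B"
      using * by (intro has_limiting_energy_of_remainder[OF p]) auto
    have degenerate: "has_limiting_energy p T y (\<lambda>t. 0) \<and> y \<notin> rough_paths p T" if "?B T = 0"
    proof
      have "?B t = 0" if t: "t \<in> {0..T}" for t
        using has_limiting_energy_bounds[OF assms(2) B t] \<open>?B T = 0\<close> by simp
      \<comment> \<open>\<open>?B\<close> is known to vanish only on \<open>{0..T}\<close>; uniform
        convergence there sees nothing else and passes to the constant \<open>0\<close>.\<close>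
      then have "uniform_limit {0..T} (\<lambda>lam. stopped_energy p lam y) ?B (fine_grids T)
          \<longleftrightarrow> uniform_limit {0..T} (\<lambda>lam. stopped_energy p lam y) (\<lambda>t. 0) (fine_grids T)"
        by (intro uniform_limit_cong') auto
      then show zero: "has_limiting_energy p T y (\<lambda>t. 0)"
        using B by (simp add: has_limiting_energy_def energy_converges_iff mono_on_def)
      show "y \<notin> rough_paths p T"
        using has_limiting_energy_unique[OF assms(2) zero, of _ T] assms(2) by (force simp: rough_paths_def)
    qed
    have "energy_converges p T y ?B"
      using B by (simp add: has_limiting_energy_def)
    moreover have "energy_measure p T y = density (energy_measure p T x) (\<lambda>s. ennreal (\<bar>g s\<bar> powr p))"
      using * B by (intro energy_measure_eq_density[OF p]) auto
    ultimately show "energy_converges p T y ?B \<and>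
          (?B T > 0 \<longrightarrow> y \<in> rough_paths p T \<and>
             energy_measure p T y = density (energy_measure p T x) (\<lambda>s. ennreal (\<bar>g s\<bar> powr p)) \<and>
             (\<forall>t\<in>{0..T}. limiting_energy p T y t = ?B t)) \<and>
          (?B T = 0 \<longrightarrow> has_limiting_energy p T y (\<lambda>t. 0) \<and> y \<notin> rough_paths p T)"
      using rough_pathsI[OF B] eq[OF B] degenerate by blast
  qed

  show "\<forall>(F :: real \<Rightarrow> real) (U :: real set).
        open U \<and> x ` {0..T} \<subseteq> U \<and> F C1_differentiable_on U \<longrightarrow>
          remainder_vanishes p T (F \<circ> x) x (deriv F \<circ> x) \<and>
          has_limiting_energy p T (F \<circ> x) (weighted_energy p T x (deriv F \<circ> x)) \<and>
          (\<forall>t\<in>{0..T}. limiting_energy p T (F \<circ> x) t = weighted_energy p T x (deriv F \<circ> x) t) \<and>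
          (weighted_energy p T x (deriv F \<circ> x) T > 0 \<longrightarrow> F \<circ> x \<in> rough_paths p T) \<and>
          ((\<exists>c>0. \<forall>u\<in>x ` {0..T}. c \<le> \<bar>deriv F u\<bar>) \<longrightarrow>
             weighted_energy p T x (deriv F \<circ> x) T > 0 \<and> F \<circ> x \<in> rough_paths p T)"
  proof (intro allI impI)
    fix F :: "real \<Rightarrow> real" and U :: "real set"
    assume *: "open U \<and> x ` {0..T} \<subseteq> U \<and> F C1_differentiable_on U"
    then have C1: "remainder_vanishes p T (F \<circ> x) x (deriv F \<circ> x)"
      "continuous_on {0..T} (F \<circ> x)" "continuous_on {0..T} (deriv F \<circ> x)"
      using C1_remainder_vanishes[OF p, of U F] by blast+
    let ?B = "weighted_energy p T x (deriv F \<circ> x)"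
    have B: "has_limiting_energy p T (F \<circ> x) ?B"
      by (rule has_limiting_energy_of_remainder[OF p C1(2,3,1)])
    have pos: "?B T > 0" if lower: "\<exists>c>0. \<forall>u\<in>x ` {0..T}. c \<le> \<bar>deriv F u\<bar>"
    proof -
      obtain c where c: "0 < c" "\<forall>u\<in>x ` {0..T}. c \<le> \<bar>deriv F u\<bar>"
        using lower by (elim exE conjE)
      then have "0 < c powr p * A T"
        using A(2) by simp
      also have "\<dots> \<le> ?B T"
        using c by (intro weighted_energy_lower_bound[OF p C1(3)]) auto
      finally show ?thesis .
    qed
    show "remainder_vanishes p T (F \<circ> x) x (deriv F \<circ> x) \<and>
          has_limiting_energy p T (F \<circ> x) ?B \<and>
          (\<forall>t\<in>{0..T}. limiting_energy p T (F \<circ> x) t = ?B t) \<and>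
          (?B T > 0 \<longrightarrow> F \<circ> x \<in> rough_paths p T) \<and>
          ((\<exists>c>0. \<forall>u\<in>x ` {0..T}. c \<le> \<bar>deriv F u\<bar>) \<longrightarrow> ?B T > 0 \<and> F \<circ> x \<in> rough_paths p T)"
      using C1(1) B eq[OF B] rough_pathsI[OF B] pos by blast
  qed

  show "\<forall>z :: real \<Rightarrow> real. continuous_on {0..T} z \<longrightarrow>
        (energy_converges p T z (\<lambda>t. 0) \<longrightarrow>
           (\<lambda>t. x t + z t) \<in> rough_paths p T \<and>
           energy_measure p T (\<lambda>t. x t + z t) = energy_measure p T x) \<and>
        (finite_variation T z \<longrightarrow> energy_converges p T z (\<lambda>t. 0)) \<and>
        ((\<exists>\<alpha>>1 / p. holder_on \<alpha> {0..T} z) \<longrightarrow> energy_converges p T z (\<lambda>t. 0))"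
  proof (intro allI impI conjI)
    fix z :: "real \<Rightarrow> real" assume z: "continuous_on {0..T} z"
    show "energy_converges p T z (\<lambda>t. 0)" if "finite_variation T z"
      by (rule finite_variation_energy[OF assms(2,1) z that])
    show "energy_converges p T z (\<lambda>t. 0)" if "\<exists>\<alpha>>1 / p. holder_on \<alpha> {0..T} z"
      using that holder_energy[OF assms(2) p] by blast
    assume "energy_converges p T z (\<lambda>t. 0)"
    then have "remainder_vanishes p T (\<lambda>t. x t + z t) x (\<lambda>s. 1)"
      by (rule remainder_vanishes_add[OF p remainder_vanishes_self])
    then have B: "has_limiting_energy p T (\<lambda>t. x t + z t) (weighted_energy p T x (\<lambda>s. 1))"
      by (intro has_limiting_energy_of_remainder[OF p] continuous_on_add x_continuous z continuous_on_const)
    show "(\<lambda>t. x t + z t) \<in> rough_paths p T"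
      using weighted_energy_one[of T] A(2) assms(2) by (intro rough_pathsI[OF B]) simp
    show "energy_measure p T (\<lambda>t. x t + z t) = energy_measure p T x"
      using energy_measure_eq_density[OF p continuous_on_const B] by (simp add: density_1)
  qed

  show "\<forall>(q :: nat) (f :: real \<Rightarrow> real).
        q \<ge> 2 \<and> even q \<and> p = real q \<and> C_k q f \<longrightarrow>
          (let Y = (\<lambda>t. f (x t) - f (x 0)
                 - 1 / fact q * (LINT s:{0..t}|energy_measure p T x. (deriv ^^ q) f (x s))) in
             (\<forall>l a :: nat \<Rightarrow> real.
                (\<forall>n. 0 < l n \<and> l n \<le> T \<and> 0 \<le> a n \<and> a n < l n) \<and>
                (\<lambda>n. mesh (uniform_grid T (l n) (a n))) \<longlonglongrightarrow> 0 \<longrightarrow>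
                (\<forall>t\<in>{0..T}. has_compensated_integral q f x (\<lambda>n. uniform_grid T (l n) (a n)) t (Y t))) \<and>
             remainder_vanishes p T Y x (deriv f \<circ> x) \<and>
             has_limiting_energy p T Y (weighted_energy p T x (deriv f \<circ> x)) \<and>
             (\<forall>t\<in>{0..T}. limiting_energy p T Y t = weighted_energy p T x (deriv f \<circ> x) t) \<and>
             ((\<exists>t\<in>{0..T}. weighted_energy p T x (deriv f \<circ> x) t \<noteq> 0) \<longrightarrow> Y \<in> rough_paths p T))"
  proof (intro allI impI, unfold Let_def, elim conjE)
    fix q :: nat and f :: "real \<Rightarrow> real"
    assume q: "2 \<le> q" "even q" "p = real q" and f: "C_k q f"
    let ?Y = "\<lambda>t. f (x t) - f (x 0) - 1 / fact q * (LINT s:{0..t}|energy_measure p T x. (deriv ^^ q) f (x s))"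
    let ?B = "weighted_energy p T x (deriv f \<circ> x)"
    note Y = compensated_remainder_vanishes[OF q(1,3) f]
    have B: "has_limiting_energy p T ?Y ?B"
      by (rule has_limiting_energy_of_remainder[OF p Y(2,3,1)])
    have integral: "has_compensated_integral q f x (\<lambda>n. uniform_grid T (l n) (a n)) t (?Y t)"
      if la: "(\<forall>n. 0 < l n \<and> l n \<le> T \<and> 0 \<le> a n \<and> a n < l n) \<and>
          (\<lambda>n. mesh (uniform_grid T (l n) (a n))) \<longlonglongrightarrow> 0" and t: "t \<in> {0..T}" for l a t
    proof -
      \<comment> \<open>The sums converge along the whole filter of fine grids, so every admissible
        sequence yields the same limit.\<close>
      have "filterlim (\<lambda>n. uniform_grid T (l n) (a n)) (fine_grids T) sequentially"
        using la by (intro filterlim_uniform_grid_mesh) blast+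
      then show ?thesis
        unfolding has_compensated_integral_def
        by (rule filterlim_compose[OF tendsto_uniform_limitI[OF compensated_sums_converge[OF q f] t]])
    qed
    have pos: "0 < ?B T" if nonzero: "\<exists>t\<in>{0..T}. ?B t \<noteq> 0"
    proof -
      obtain t where t: "t \<in> {0..T}" "?B t \<noteq> 0"
        using nonzero ..
      then show ?thesis
        using has_limiting_energy_bounds[OF assms(2) B t(1)] by simp
    qed
    show "(\<forall>l a :: nat \<Rightarrow> real.
                (\<forall>n. 0 < l n \<and> l n \<le> T \<and> 0 \<le> a n \<and> a n < l n) \<and>
                (\<lambda>n. mesh (uniform_grid T (l n) (a n))) \<longlonglongrightarrow> 0 \<longrightarrow>
                (\<forall>t\<in>{0..T}. has_compensated_integral q f x (\<lambda>n. uniform_grid T (l n) (a n)) t (?Y t))) \<and>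
             remainder_vanishes p T ?Y x (deriv f \<circ> x) \<and>
             has_limiting_energy p T ?Y ?B \<and>
             (\<forall>t\<in>{0..T}. limiting_energy p T ?Y t = ?B t) \<and>
             ((\<exists>t\<in>{0..T}. ?B t \<noteq> 0) \<longrightarrow> ?Y \<in> rough_paths p T)"
    proof (intro conjI allI impI ballI)
      show "?Y \<in> rough_paths p T" if "\<exists>t\<in>{0..T}. ?B t \<noteq> 0"
        by (rule rough_pathsI[OF B pos[OF that]])
    qed (rule integral Y(1) B eq[OF B]; assumption)+
  qed
qed

end
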